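(* Let $\mathcal{E}\subset\mathcal{P}_n$ be a maximal correctable error set containing the identity, and let $R=\{R_\chi\}_{\chi\in\hat G\setminus\{1\}}$ be a complete set of frame fields adapted to $\mathcal{E}$. Then there exist a Hilbert space $\mathcal{H}_{\rm gauge}$ and a (frame-dependent) tensor product $\otimes_R$, i.e. a bilinear map $\otimes_R:\mathcal{H}_{\rm pn}\times\mathcal{H}_{\rm gauge}\to\mathcal{H}_{\rm kin}$ whose linear extension to $\mathcal{H}_{\rm pn}\otimes\mathcal{H}_{\rm gauge}$ is a linear isomorphism onto $\mathcal{H}_{\rm kin}$ (written $\mathcal{H}_{\rm kin}=\mathcal{H}_{\rm pn}\otimes_R\mathcal{H}_{\rm gauge}$), such that: 1. $\dim\mathcal{H}_{\rm gauge}=2^{n-k}$ and $\mathcal{H}_{\rm gauge}$ carries a unitary representation $U_R$ of $G$ with $U^g(\ket{\psi}\otimes_R\ket{w})=\ket{\psi}\otimes_R U^g_R\ket{w}$ for all $g\in G$, $\ket\psi\in\mathcal{H}_{\rm pn}$, $\ket w\in\mathcal{H}_{\rm gauge}$ (i.e. $U^g=\mathrm{id}_{\mathcal{H}_{\rm pn}}\otimes_RU^g_R$); 2. $\mathcal{H}_{\rm gauge}$ has an orthonormal basis $\{\ket\chi\}_{\chi\in\hat G}$ with $\mathcal{H}_\chi=\mathcal{H}_{\rm pn}\otimes_R\ket\chi$ for all $\chi\in\hat G$; 3. for every $\ket\psi\in\mathcal{H}_{\rm pn}$ and $\chi\in\hat G$, $R_\chi(\ket\psi\otimes_R\ket1)=\ket\psi\otimes_R\ket\chi$;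 4. for every $\chi\in\hat G$ and every $E_\chi\in\mathcal{E}\cap C_\chi$ there is $\eta\in\mathbb{C}$, $|\eta|=1$, with $E_\chi(\ket\psi\otimes_R\ket1)=\eta\ket\psi\otimes_R\ket\chi$ for all $\ket\psi\in\mathcal{H}_{\rm pn}$; 5. $U_R$ is isomorphic to the regular representation of $G$.
   Context: Let $n\ge1$, $0\le k<n$, $\mathcal{H}_{\rm kin}=(\mathbb{C}^2)^{\otimes n}$, $\mathcal{P}_n$ the $n$-qubit Pauli group. Let $G=\mathbb{Z}_2^{\times(n-k)}$ and $U:G\to\mathcal{P}_n$, $g\mapsto U^g$, a faithful unitary representation with $-I\notin U(G)$. $\mathcal{H}_{\rm pn}=\{\psi:U^g\psi=\psi\ \forall g\}$, $\Pi_{\rm pn}=\frac1{|G|}\sum_gU^g$. $\hat G$ is the group of characters $\chi:G\to\{\pm1\}$, with trivial character $1$; $\mathcal{H}_\chi$ is the image of $P_\chi=\frac1{|G|}\sum_g\chi(g)U^g$ (so $\mathcal{H}_1=\mathcal{H}_{\rm pn}$), and $C_\chi=\{E\in\mathcal{P}_n:U^gE(U^g)^\dagger=\chi(g)E\ \forall g\}$. A set $\{E_i\}$ is correctable if $\Pi_{\rm pn}E_i^\dagger E_j\Pi_{\rm pn}=C_{ij}\Pi_{\rm pn}$ with $(C_{ij})$ Hermitian, and maximal if $\mathrm{rank}(C)=2^{n-k}$. A frame field of charge $\chi\in\hat G\setminus\{1\}$ is an isometry $R_\chi:\mathcal{H}_{\rm pn}\to\mathcal{H}_\chi$; a complete set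 of frame fields is a collection $R=\{R_\chi\}_{\chi\ne1}$, one for each nontrivial $\chi$; by convention $R_1:=\mathrm{id}_{\mathcal{H}_{\rm pn}}$. $R$ is adapted to $\mathcal{E}$ if for every $\chi\ne1$ there are $E_\chi\in\mathcal{E}\cap C_\chi$ and $\eta_\chi\in\mathbb{C}$, $|\eta_\chi|=1$, with $R_\chi=\eta_\chi E_\chi|_{\mathcal{H}_{\rm pn}}$ (equivalently, the recovery channel $\mathcal{O}_R(\rho)=\Pi_{\rm pn}\rho\Pi_{\rm pn}+\sum_{\chi\ne1}R_\chi^{-1}P_\chi\rho P_\chi R_\chi$ corrects $\mathcal{E}$). *)

theory Defs
  imports "Jordan_Normal_Form.Schur_Decomposition" "Jordan_Normal_Form.DL_Rank"
begin

text \<open>Conventions. The kinematic space (C^2)^{\<otimes> n} is complex vec of dimension 2^n, the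
computational basis vector |x> being unit_vec (2^n) x, where bit t of x is the state of qubit t.
The group G = Z_2^m (m = n - k) is the set of naturals g < 2^m with group law XOR (identity 0).
Characters are functions nat => complex with values +-1 on G, multiplicative, and (for
extensionality) equal to 1 outside G.\<close>

definition bitdot :: "nat \<Rightarrow> nat \<Rightarrow> nat \<Rightarrow> nat" where
  "bitdot n b j = card {t. t < n \<and> bit b t \<and> bit j t}"

definition pauli_XZ :: "nat \<Rightarrow> nat \<Rightarrow> nat \<Rightarrow> complex mat" where
  "pauli_XZ n a b = mat (2^n) (2^n)
     (\<lambda>(i, j). if i = Bit_Operations.xor a j then (-1) ^ bitdot n b j else 0)"

definition pauli_group :: "nat \<Rightarrow> complex mat set" where
  "pauli_group n = {c \<cdot>\<^sub>m pauli_XZ n a b | c a b.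
      c \<in> {1, \<i>, -1, -\<i>} \<and> a < 2^n \<and> b < 2^n}"

definition pauli_rep :: "nat \<Rightarrow> nat \<Rightarrow> (nat \<Rightarrow> complex mat) \<Rightarrow> bool" where
  "pauli_rep n m U \<longleftrightarrow>
     (\<forall>g < 2^m. U g \<in> pauli_group n) \<and>
     U 0 = 1\<^sub>m (2^n) \<and>
     (\<forall>g < 2^m. \<forall>h < 2^m. U (Bit_Operations.xor g h) = U g * U h) \<and>
     inj_on U {..<2^m} \<and>
     (\<forall>g < 2^m. U g \<noteq> (-1) \<cdot>\<^sub>m 1\<^sub>m (2^n))"

definition chars :: "nat \<Rightarrow> (nat \<Rightarrow> complex) set" where
  "chars m = {\<chi>. (\<forall>g < 2^m. \<chi> g = 1 \<or> \<chi> g = -1) \<and>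
                 (\<forall>g < 2^m. \<forall>h < 2^m. \<chi> (Bit_Operations.xor g h) = \<chi> g * \<chi> h) \<and>
                 (\<forall>g. 2^m \<le> g \<longrightarrow> \<chi> g = 1)}"

definition triv_char :: "nat \<Rightarrow> complex" where
  "triv_char = (\<lambda>_. 1)"

definition char_proj :: "nat \<Rightarrow> nat \<Rightarrow> (nat \<Rightarrow> complex mat) \<Rightarrow> (nat \<Rightarrow> complex) \<Rightarrow> complex mat" where
  "char_proj n m U \<chi> = mat (2^n) (2^n)
     (\<lambda>(i, j). (\<Sum>g<2^m. \<chi> g * U g $$ (i, j)) / 2^m)"

definition char_space :: "nat \<Rightarrow> nat \<Rightarrow> (nat \<Rightarrow> complex mat) \<Rightarrow> (nat \<Rightarrow> complex) \<Rightarrow> complex vec set" where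
  "char_space n m U \<chi> = (\<lambda>w. char_proj n m U \<chi> *\<^sub>v w) ` carrier_vec (2^n)"

abbreviation pn_proj where "pn_proj n m U \<equiv> char_proj n m U triv_char"
abbreviation pn_space where "pn_space n m U \<equiv> char_space n m U triv_char"

definition charge_ops :: "nat \<Rightarrow> nat \<Rightarrow> (nat \<Rightarrow> complex mat) \<Rightarrow> (nat \<Rightarrow> complex) \<Rightarrow> complex mat set" where
  "charge_ops n m U \<chi> = {E \<in> pauli_group n.
      \<forall>g < 2^m. U g * E * mat_adjoint (U g) = \<chi> g \<cdot>\<^sub>m E}"

text \<open>Correctable and maximal: Pi E^dag F Pi = C_{EF} Pi with C Hermitian and rank C = 2^m.
The rank of the matrix (C_{EF}) indexed by the finite set Es is computed with respect to an
arbitrary enumeration of Es (the rank does not depend on it).\<close>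
definition maximal_correctable :: "nat \<Rightarrow> nat \<Rightarrow> (nat \<Rightarrow> complex mat) \<Rightarrow> complex mat set \<Rightarrow> bool" where
  "maximal_correctable n m U Es \<longleftrightarrow>
     (\<exists>C :: complex mat \<Rightarrow> complex mat \<Rightarrow> complex.
        (\<forall>E\<in>Es. \<forall>F\<in>Es. pn_proj n m U * (mat_adjoint E * F) * pn_proj n m U
                          = C E F \<cdot>\<^sub>m pn_proj n m U) \<and>
        (\<forall>E\<in>Es. \<forall>F\<in>Es. C F E = cnj (C E F)) \<and>
        (\<exists>es. distinct es \<and> set es = Es \<and>
           vec_space.rank (length es)
              (mat (length es) (length es) (\<lambda>(i, j). C (es ! i) (es ! j))) = 2^m))"

definition cinner :: "complex vec \<Rightarrow> complex vec \<Rightarrow> complex" where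
  "cinner v w = (\<Sum>i<dim_vec v. cnj (v $ i) * w $ i)"

definition frame_field :: "nat \<Rightarrow> nat \<Rightarrow> (nat \<Rightarrow> complex mat) \<Rightarrow> (nat \<Rightarrow> complex)
    \<Rightarrow> (complex vec \<Rightarrow> complex vec) \<Rightarrow> bool" where
  "frame_field n m U \<chi> Rc \<longleftrightarrow>
     (\<forall>\<psi>\<in>pn_space n m U. Rc \<psi> \<in> char_space n m U \<chi>) \<and>
     (\<forall>\<psi>\<in>pn_space n m U. \<forall>\<phi>\<in>pn_space n m U. \<forall>a.
         Rc (a \<cdot>\<^sub>v \<psi> + \<phi>) = a \<cdot>\<^sub>v Rc \<psi> + Rc \<phi>) \<and>
     (\<forall>\<psi>\<in>pn_space n m U. \<forall>\<phi>\<in>pn_space n m U. cinner (Rc \<psi>) (Rc \<phi>) = cinner \<psi> \<phi>)"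

definition complete_frame :: "nat \<Rightarrow> nat \<Rightarrow> (nat \<Rightarrow> complex mat)
    \<Rightarrow> ((nat \<Rightarrow> complex) \<Rightarrow> complex vec \<Rightarrow> complex vec) \<Rightarrow> bool" where
  "complete_frame n m U R \<longleftrightarrow> (\<forall>\<chi> \<in> chars m - {triv_char}. frame_field n m U \<chi> (R \<chi>))"

definition adapted :: "nat \<Rightarrow> nat \<Rightarrow> (nat \<Rightarrow> complex mat) \<Rightarrow> complex mat set
    \<Rightarrow> ((nat \<Rightarrow> complex) \<Rightarrow> complex vec \<Rightarrow> complex vec) \<Rightarrow> bool" where
  "adapted n m U Es R \<longleftrightarrow>
     (\<forall>\<chi> \<in> chars m - {triv_char}. \<exists>E \<in> Es \<inter> charge_ops n m U \<chi>. \<exists>\<eta>::complex.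
        cmod \<eta> = 1 \<and> (\<forall>\<psi>\<in>pn_space n m U. R \<chi> \<psi> = \<eta> \<cdot>\<^sub>v (E *\<^sub>v \<psi>)))"

definition frame_ext :: "((nat \<Rightarrow> complex) \<Rightarrow> complex vec \<Rightarrow> complex vec)
    \<Rightarrow> (nat \<Rightarrow> complex) \<Rightarrow> complex vec \<Rightarrow> complex vec" where
  "frame_ext R \<chi> = (if \<chi> = triv_char then id else R \<chi>)"

definition lincomb :: "nat \<Rightarrow> (nat \<Rightarrow> complex) \<Rightarrow> complex vec list \<Rightarrow> complex vec" where
  "lincomb N c vs = vec N (\<lambda>t. \<Sum>i<length vs. c i * (vs ! i) $ t)"

definition is_basis_list :: "nat \<Rightarrow> complex vec set \<Rightarrow> complex vec list \<Rightarrow> bool" where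
  "is_basis_list N S vs \<longleftrightarrow> set vs \<subseteq> S \<and>
     (\<forall>c. lincomb N c vs = 0\<^sub>v N \<longrightarrow> (\<forall>i<length vs. c i = 0)) \<and>
     (\<forall>v\<in>S. \<exists>c. v = lincomb N c vs)"

text \<open>T : H_pn x C^d -> H_kin is bilinear and its linear extension to H_pn (x) C^d is a
linear isomorphism onto H_kin, i.e. it maps the product basis {b_i (x) e_j} (b a basis of H_pn,
e the standard basis of C^d) onto a basis of H_kin.\<close>
definition tensor_structure :: "nat \<Rightarrow> nat \<Rightarrow> (nat \<Rightarrow> complex mat) \<Rightarrow> nat
    \<Rightarrow> (complex vec \<Rightarrow> complex vec \<Rightarrow> complex vec) \<Rightarrow> bool" where
  "tensor_structure n m U d T \<longleftrightarrow>
     (\<forall>\<psi>\<in>pn_space n m U. \<forall>w\<in>carrier_vec d. T \<psi> w \<in> carrier_vec (2^n)) \<and>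
     (\<forall>\<psi>\<in>pn_space n m U. \<forall>\<phi>\<in>pn_space n m U. \<forall>w\<in>carrier_vec d. \<forall>a.
         T (a \<cdot>\<^sub>v \<psi> + \<phi>) w = a \<cdot>\<^sub>v T \<psi> w + T \<phi> w) \<and>
     (\<forall>\<psi>\<in>pn_space n m U. \<forall>w\<in>carrier_vec d. \<forall>v\<in>carrier_vec d. \<forall>a.
         T \<psi> (a \<cdot>\<^sub>v w + v) = a \<cdot>\<^sub>v T \<psi> w + T \<psi> v) \<and>
     (\<forall>bs. is_basis_list (2^n) (pn_space n m U) bs \<longrightarrow>
         is_basis_list (2^n) (carrier_vec (2^n))
            (concat (map (\<lambda>b. map (\<lambda>j. T b (unit_vec d j)) [0..<d]) bs)))"

definition regular_rep :: "nat \<Rightarrow> nat \<Rightarrow> complex mat" where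
  "regular_rep m g = mat (2^m) (2^m) (\<lambda>(i, j). if i = Bit_Operations.xor g j then 1 else 0)"

end

theory Submission
  imports Defs
begin

text \<open>
  The kinematic space is the direct sum of the isotypic components \<open>H\<^sub>\<chi>\<close>, and a Pauli operator of
  charge \<open>\<chi>\<close> maps the code space \<open>H\<^sub>p\<^sub>n\<close> unitarily onto \<open>H\<^sub>\<chi>\<close>. Hence each frame field \<open>R\<^sub>\<chi>\<close>, being
  a phase times such an operator, identifies \<open>H\<^sub>\<chi>\<close> with a copy of the code space labelled by \<open>\<chi>\<close>.
  Taking the space of functions on \<open>G\<close> as gauge space and the normalised characters as its basis
  \<open>|\<chi>\<rangle>\<close>, the rule \<open>\<psi> \<otimes> |\<chi>\<rangle> = R\<^sub>\<chi> \<psi>\<close> defines the tensor product. Translations act on \<open>|\<chi>\<rangle>\<close>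
  through \<open>\<chi>\<close>, just as \<open>U\<close> acts on \<open>H\<^sub>\<chi>\<close>, so \<open>U\<^sub>R\<close> is the regular representation itself.
\<close>

section \<open>Characters of $Z_2^m$\<close>

lemma xor_less_two_power:
  fixes g h :: nat
  assumes "g < 2^m" "h < 2^m"
  shows "Bit_Operations.xor g h < 2^m"
  using assms by (metis take_bit_nat_eq_self_iff take_bit_xor)

lemma xor_xor_cancel_left [simp]:
  fixes g h :: nat
  shows "Bit_Operations.xor g (Bit_Operations.xor g h) = h"
  by (simp add: xor.assoc[symmetric])

lemma sum_xor_reindex:
  fixes f :: "nat \<Rightarrow> 'a::comm_monoid_add"
  assumes "h < 2^m"
  shows "(\<Sum>g<2^m. f (Bit_Operations.xor h g)) = (\<Sum>g<2^m. f g)"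
  by (rule sum.reindex_bij_witness[of _ "Bit_Operations.xor h" "Bit_Operations.xor h"])
     (auto intro: xor_less_two_power assms)

lemma chars_eqI:
  assumes "\<chi> \<in> chars m" "\<chi>' \<in> chars m" "\<And>g. g < 2^m \<Longrightarrow> \<chi> g = \<chi>' g"
  shows "\<chi> = \<chi>'"
proof
  fix g
  show "\<chi> g = \<chi>' g"
    using assms by (cases "g < 2^m") (auto simp: chars_def)
qed

lemma chars_xor:
  assumes "\<chi> \<in> chars m" "g < 2^m" "h < 2^m"
  shows "\<chi> (Bit_Operations.xor g h) = \<chi> g * \<chi> h"
  using assms by (auto simp: chars_def)

lemma chars_square [simp]:
  assumes "\<chi> \<in> chars m"
  shows "\<chi> g * \<chi> g = 1"
  using assms by (cases "g < 2^m") (auto simp: chars_def)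

lemma chars_cnj [simp]:
  assumes "\<chi> \<in> chars m"
  shows "cnj (\<chi> g) = \<chi> g"
  using assms by (cases "g < 2^m") (auto simp: chars_def)

lemma chars_zero [simp]:
  assumes "\<chi> \<in> chars m"
  shows "\<chi> 0 = 1"
  using chars_xor[OF assms, of 0 0] chars_square[OF assms, of 0] by simp

lemma triv_char_apply [simp]: "triv_char g = 1"
  by (simp add: triv_char_def)

lemma triv_char_in_chars [simp]: "triv_char \<in> chars m"
  by (auto simp: chars_def triv_char_def)

lemma chars_times:
  assumes "\<chi> \<in> chars m" "\<chi>' \<in> chars m"
  shows "(\<lambda>g. \<chi> g * \<chi>' g) \<in> chars m"
  using assms by (fastforce simp: chars_def)

text \<open>The prescribed value 1 outside the group leaves only finitely many free values. Singling
  out one term of a sum over \<open>chars m\<close> relies on this.\<close>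

lemma finite_chars: "finite (chars m)"
proof -
  let ?F = "{f. \<forall>g. (g \<in> {..<2^m} \<longrightarrow> f g \<in> {1, -1}) \<and> (g \<notin> {..<2^m} \<longrightarrow> f g = (1::complex))} :: (nat \<Rightarrow> complex) set"
  have "finite ?F"
    by (rule finite_set_of_finite_funs) auto
  then show ?thesis
    by (rule finite_subset[rotated]) (auto simp: chars_def)
qed

text \<open>Translation by some \<open>h\<close> with \<open>\<chi> h \<noteq> 1\<close> permutes
  the group and multiplies the sum by \<open>\<chi> h\<close>, so a nontrivial character sums to
  zero.\<close>

lemma sum_char:
  assumes "\<chi> \<in> chars m"
  shows "(\<Sum>g<2^m. \<chi> g) = (if \<chi> = triv_char then 2^m else 0)"
proof (cases "\<chi> = triv_char")
  case True
  then show ?thesis by (simp add: triv_char_def)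
next
  case False
  then obtain h where h: "h < 2^m" "\<chi> h \<noteq> 1"
    using chars_eqI[OF assms triv_char_in_chars] by (auto simp: triv_char_def)
  have "(\<Sum>g<2^m. \<chi> g) = (\<Sum>g<2^m. \<chi> (Bit_Operations.xor h g))"
    by (rule sum_xor_reindex[OF h(1), symmetric])
  also have "\<dots> = \<chi> h * (\<Sum>g<2^m. \<chi> g)"
    by (simp add: chars_xor[OF assms h(1)] sum_distrib_left)
  finally show ?thesis
    using h(2) False by simp
qed

text \<open>The pointwise product of two characters is again a character and, as values square to 1,
  is trivial exactly when the two agree; \<open>sum_char\<close> then applies. The values are real,
  so this is the usual Hermitian orthogonality.\<close>

lemma char_orthogonality:
  assumes "\<chi> \<in> chars m" "\<chi>' \<in> chars m"
  shows "(\<Sum>g<2^m. \<chi> g * \<chi>' g) = (if \<chi> = \<chi>' then 2^m else 0)"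
proof -
  have "\<chi> = \<chi>'" if "(\<lambda>g. \<chi> g * \<chi>' g) = triv_char"
  proof
    fix g
    have "\<chi> g * \<chi>' g = 1"
      using that by (metis triv_char_def)
    then have "\<chi> g * \<chi>' g = \<chi>' g * \<chi>' g"
      using assms by simp
    moreover have "\<chi>' g \<noteq> 0"
      using chars_square[OF assms(2), of g] by auto
    ultimately show "\<chi> g = \<chi>' g"
      by simp
  qed
  moreover have "(\<lambda>g. \<chi> g * \<chi> g) = triv_char"
    using assms by (simp add: triv_char_def)
  ultimately show ?thesis
    using sum_char[OF chars_times[OF assms]] by auto
qed

text \<open>The coordinate character given by the sign of bit \<open>t\<close>. A nonzero group
  element has a set bit, so one of these separates it from 0.\<close>

definition bit_char :: "nat \<Rightarrow> nat \<Rightarrow> nat \<Rightarrow> complex" where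
  "bit_char m t g = (if g < 2^m \<and> bit g t then -1 else 1)"

lemma bit_char_in_chars: "bit_char m t \<in> chars m"
  by (auto simp: chars_def bit_char_def bit_xor_iff xor_less_two_power)

text \<open>For a bit \<open>t\<close> set in \<open>g\<close>, multiplication by
  \<open>bit_char m t\<close> is an involution of the characters that flips the sign of every value
  at \<open>g\<close>; the sum equals its own negative.\<close>

lemma sum_chars_nonzero:
  assumes "g < 2^m" "g \<noteq> 0"
  shows "(\<Sum>\<chi>\<in>chars m. \<chi> g) = 0"
proof -
  obtain t where t: "bit g t"
    using assms(2) by (metis bit_eq_iff bit_0_eq bot_apply bot_bool_def)
  let ?f = "\<lambda>\<chi> g. bit_char m t g * \<chi> g"
  have "(\<Sum>\<chi>\<in>chars m. \<chi> g) = (\<Sum>\<chi>\<in>chars m. ?f \<chi> g)"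
    by (rule sum.reindex_bij_witness[of _ ?f ?f])
       (auto simp: chars_times[OF bit_char_in_chars] mult.assoc[symmetric]
          chars_square[OF bit_char_in_chars])
  also have "\<dots> = - (\<Sum>\<chi>\<in>chars m. \<chi> g)"
    using assms t by (simp add: bit_char_def sum_negf)
  finally show ?thesis
    by simp
qed

text \<open>Double counting of \<open>\<Sum>\<^sub>g \<Sum>\<^sub>\<chi> \<chi> g\<close> avoids an explicit enumeration of the characters.\<close>

lemma card_chars: "card (chars m) = 2^m"
proof -
  have "(\<Sum>g<2^m. \<Sum>\<chi>\<in>chars m. \<chi> g) = (\<Sum>\<chi>\<in>chars m. if \<chi> = triv_char then 2^m else 0)"
    by (subst sum.swap) (simp add: sum_char)
  also have "\<dots> = 2^m"
    using finite_chars[of m] by simp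
  finally have 1: "(\<Sum>g<2^m. \<Sum>\<chi>\<in>chars m. \<chi> g) = 2^m" .
  have "(\<Sum>g<2^m. \<Sum>\<chi>\<in>chars m. \<chi> g)
      = (\<Sum>g<2^m. if g = (0::nat) then of_nat (card (chars m)) else (0::complex))"
    by (intro sum.cong) (auto simp: sum_chars_nonzero)
  then have "of_nat (card (chars m)) = (of_nat (2^m) :: complex)"
    using 1 by simp
  then show ?thesis
    by (simp only: of_nat_eq_iff)
qed

text \<open>On the diagonal every term is 1 and the characters are counted; off it the terms are the
  values at the nonzero element \<open>xor g h\<close>.\<close>

lemma char_column_orthogonality:
  assumes "g < 2^m" "h < 2^m"
  shows "(\<Sum>\<chi>\<in>chars m. \<chi> g * \<chi> h) = (if g = h then 2^m else 0)"
proof (cases "g = h")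
  case True
  then show ?thesis
    by (simp add: card_chars)
next
  case False
  then have "Bit_Operations.xor g h \<noteq> 0"
    by (metis xor_xor_cancel_left xor.right_neutral)
  moreover have "(\<Sum>\<chi>\<in>chars m. \<chi> g * \<chi> h) = (\<Sum>\<chi>\<in>chars m. \<chi> (Bit_Operations.xor g h))"
    by (intro sum.cong) (auto simp: chars_xor assms)
  ultimately show ?thesis
    using False by (simp add: sum_chars_nonzero xor_less_two_power assms)
qed

section \<open>Vectors, adjoints and Pauli matrices\<close>

lemma index_mult_mat_vec_sum:
  assumes "A \<in> carrier_mat N M" "v \<in> carrier_vec M" "i < N"
  shows "(A *\<^sub>v v) $ i = (\<Sum>j<M. A $$ (i, j) * v $ j)"
  using assms by (auto simp: scalar_prod_def lessThan_atLeast0)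

text \<open>Sums of vectors are written throughout as vectors of entrywise sums, so linearity is
  needed in this form; it amounts to exchanging two finite sums.\<close>

lemma mult_mat_vec_vec_sum:
  fixes A :: "complex mat"
  assumes A: "A \<in> carrier_mat N N" and f: "\<And>x. x \<in> X \<Longrightarrow> f x \<in> carrier_vec N"
  shows "A *\<^sub>v vec N (\<lambda>t. \<Sum>x\<in>X. c x * f x $ t) = vec N (\<lambda>t. \<Sum>x\<in>X. c x * (A *\<^sub>v f x) $ t)"
proof
  fix i
  assume "i < dim_vec (vec N (\<lambda>t. \<Sum>x\<in>X. c x * (A *\<^sub>v f x) $ t))"
  then have i: "i < N"
    by simp
  have "(A *\<^sub>v vec N (\<lambda>t. \<Sum>x\<in>X. c x * f x $ t)) $ i
      = (\<Sum>j<N. \<Sum>x\<in>X. A $$ (i, j) * (c x * f x $ j))"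
    by (subst index_mult_mat_vec_sum[OF A _ i]) (auto simp: sum_distrib_left)
  also have "\<dots> = (\<Sum>x\<in>X. \<Sum>j<N. A $$ (i, j) * (c x * f x $ j))"
    by (rule sum.swap)
  also have "\<dots> = (\<Sum>x\<in>X. c x * (A *\<^sub>v f x) $ i)"
    by (intro sum.cong refl)
       (simp add: index_mult_mat_vec_sum[OF A f i] sum_distrib_left mult_ac del: index_mult_mat_vec)
  finally show "(A *\<^sub>v vec N (\<lambda>t. \<Sum>x\<in>X. c x * f x $ t)) $ i
      = vec N (\<lambda>t. \<Sum>x\<in>X. c x * (A *\<^sub>v f x) $ t) $ i"
    using i by simp
qed (use A in simp)

lemma mult_mat_zero_vec:
  fixes A :: "'a::semiring_0 mat"
  shows "A \<in> carrier_mat N M \<Longrightarrow> A *\<^sub>v 0\<^sub>v M = 0\<^sub>v N"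
  by (intro eq_vecI) auto

lemma smult_mat_mult_vec:
  fixes A :: "'a::comm_ring_1 mat"
  assumes "A \<in> carrier_mat N M" "v \<in> carrier_vec M"
  shows "(a \<cdot>\<^sub>m A) *\<^sub>v v = a \<cdot>\<^sub>v (A *\<^sub>v v)"
  using assms by (auto simp: scalar_prod_def sum_distrib_left mult.assoc)

lemma mat_adjoint_carrier [simp]:
  "A \<in> carrier_mat N M \<Longrightarrow> mat_adjoint A \<in> carrier_mat M N"
  by (auto simp: mat_adjoint_def mat_of_rows_def)

lemma index_mat_adjoint:
  fixes A :: "complex mat"
  assumes "A \<in> carrier_mat N M" "i < M" "j < N"
  shows "mat_adjoint A $$ (i, j) = cnj (A $$ (j, i))"
  using assms by (auto simp: mat_adjoint_def mat_of_rows_def)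

lemma index_mat_adjoint_mult:
  fixes A :: "complex mat"
  assumes "A \<in> carrier_mat N M" "B \<in> carrier_mat N K" "i < M" "j < K"
  shows "(mat_adjoint A * B) $$ (i, j) = (\<Sum>l<N. cnj (A $$ (l, i)) * B $$ (l, j))"
proof -
  have "(mat_adjoint A * B) $$ (i, j) = (\<Sum>l<N. mat_adjoint A $$ (i, l) * B $$ (l, j))"
    using assms carrier_matD[OF mat_adjoint_carrier[OF assms(1)]]
    by (auto simp: scalar_prod_def lessThan_atLeast0)
  also have "\<dots> = (\<Sum>l<N. cnj (A $$ (l, i)) * B $$ (l, j))"
    by (intro sum.cong refl) (simp add: index_mat_adjoint[OF assms(1,3)])
  finally show ?thesis .
qed

section \<open>Unitarity of Pauli matrices and of translations\<close>

lemma xor_monomial_mat_unitary: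
  fixes f :: "nat \<Rightarrow> complex"
  assumes a: "a < 2^n" and f: "\<And>j. cmod (f j) = 1"
  defines "A \<equiv> mat (2^n) (2^n) (\<lambda>(i, j). if i = Bit_Operations.xor a j then f j else 0)"
  shows "mat_adjoint A * A = 1\<^sub>m (2^n)"
proof
  have A: "A \<in> carrier_mat (2^n) (2^n)"
    by (simp add: A_def)
  show "dim_row (mat_adjoint A * A) = dim_row (1\<^sub>m (2^n))"
    "dim_col (mat_adjoint A * A) = dim_col (1\<^sub>m (2^n))"
    using A carrier_matD[OF mat_adjoint_carrier[OF A]] by auto
  fix i j
  assume "i < dim_row (1\<^sub>m (2^n))" "j < dim_col (1\<^sub>m (2^n))"
  then have ij: "i < 2^n" "j < 2^n"
    by auto
  have "(mat_adjoint A * A) $$ (i, j) = (\<Sum>l<2^n. cnj (A $$ (l, i)) * A $$ (l, j))"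
    by (rule index_mat_adjoint_mult[OF A A ij])
  \<comment> \<open>Column \<open>i\<close> has its only nonzero entry, a phase, in row
    \<open>xor a i\<close>; hence distinct columns have disjoint supports.\<close>
  also have "\<dots> = (\<Sum>l<2^n. if l = Bit_Operations.xor a i then (if i = j then 1 else 0) else 0)"
  proof (intro sum.cong refl)
    fix l :: nat
    assume "l \<in> {..<2^n}"
    moreover have "cnj (f i) * f i = 1"
      using f[of i] complex_norm_square[of "f i"] by (simp add: mult.commute)
    moreover have "i = j" if "Bit_Operations.xor a i = Bit_Operations.xor a j"
      using that by (metis xor_xor_cancel_left)
    ultimately show "cnj (A $$ (l, i)) * A $$ (l, j)
        = (if l = Bit_Operations.xor a i then (if i = j then 1 else 0) else 0)"
      using ij by (auto simp: A_def)
  qed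
  also have "\<dots> = 1\<^sub>m (2^n) $$ (i, j)"
    using ij xor_less_two_power[OF a ij(1)] by simp
  finally show "(mat_adjoint A * A) $$ (i, j) = 1\<^sub>m (2^n) $$ (i, j)" .
qed

lemma pauli_group_carrier:
  assumes "E \<in> pauli_group n"
  shows "E \<in> carrier_mat (2^n) (2^n)"
  using assms by (auto simp: pauli_group_def pauli_XZ_def)

lemma pauli_group_unitary:
  assumes "E \<in> pauli_group n"
  shows "mat_adjoint E * E = 1\<^sub>m (2^n)"
proof -
  obtain c a b where c: "c \<in> {1, \<i>, -1, -\<i>}" and a: "a < 2^n"
    and E: "E = c \<cdot>\<^sub>m pauli_XZ n a b"
    using assms by (auto simp: pauli_group_def)
  have "E = mat (2^n) (2^n)
      (\<lambda>(i, j). if i = Bit_Operations.xor a j then c * (-1) ^ bitdot n b j else 0)"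
    by (auto simp: E pauli_XZ_def)
  moreover have "cmod (c * (-1) ^ bitdot n b j) = 1" for j
    using c by (auto simp: norm_mult norm_power)
  ultimately show ?thesis
    using xor_monomial_mat_unitary[OF a] by simp
qed

lemma regular_rep_unitary:
  assumes "g < 2^m"
  shows "mat_adjoint (regular_rep m g) * regular_rep m g = 1\<^sub>m (2^m)"
  unfolding regular_rep_def by (rule xor_monomial_mat_unitary[OF assms]) simp

lemma regular_rep_carrier [simp]: "regular_rep m g \<in> carrier_mat (2^m) (2^m)"
  by (simp add: regular_rep_def)

lemma regular_rep_zero: "regular_rep m 0 = 1\<^sub>m (2^m)"
  by (auto simp: regular_rep_def)

text \<open>Row \<open>i\<close> has its single 1 in column \<open>xor g i\<close>, because xor by
  \<open>g\<close> is its own inverse.\<close>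

lemma regular_rep_mult_vec:
  assumes "g < 2^m" "w \<in> carrier_vec (2^m)" "i < 2^m"
  shows "(regular_rep m g *\<^sub>v w) $ i = w $ (Bit_Operations.xor g i)"
proof -
  have "(regular_rep m g *\<^sub>v w) $ i = (\<Sum>j<2^m. regular_rep m g $$ (i, j) * w $ j)"
    by (rule index_mult_mat_vec_sum[OF regular_rep_carrier assms(2,3)])
  also have "\<dots> = (\<Sum>j<2^m. if j = Bit_Operations.xor g i then w $ j else 0)"
    by (intro sum.cong refl) (use assms in \<open>auto simp: regular_rep_def\<close>)
  also have "\<dots> = w $ (Bit_Operations.xor g i)"
    using xor_less_two_power[OF assms(1,3)] by simp
  finally show ?thesis .
qed

lemma regular_rep_xor:
  assumes "g < 2^m" "h < 2^m"
  shows "regular_rep m (Bit_Operations.xor g h) = regular_rep m g * regular_rep m h"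
proof
  fix i j
  assume "i < dim_row (regular_rep m g * regular_rep m h)"
    "j < dim_col (regular_rep m g * regular_rep m h)"
  then have ij: "i < 2^m" "j < 2^m"
    by (auto simp: regular_rep_def)
  have "(regular_rep m g * regular_rep m h) $$ (i, j)
      = (regular_rep m g *\<^sub>v col (regular_rep m h) j) $ i"
    using ij by (simp add: regular_rep_def)
  also have "\<dots> = col (regular_rep m h) j $ (Bit_Operations.xor g i)"
    by (rule regular_rep_mult_vec[OF assms(1) _ ij(1)]) (simp add: carrier_vecI carrier_matD[OF regular_rep_carrier])
  also have "\<dots> = regular_rep m (Bit_Operations.xor g h) $$ (i, j)"
    using ij xor_less_two_power[OF assms(1) ij(1)]
    by (auto simp: regular_rep_def xor.assoc) (metis xor_xor_cancel_left)
  finally show "regular_rep m (Bit_Operations.xor g h) $$ (i, j)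
      = (regular_rep m g * regular_rep m h) $$ (i, j)"
    by simp
qed (auto simp: regular_rep_def)

text \<open>The matrix moves to the other argument as its adjoint, where unitarity cancels
  it.\<close>

lemma cinner_unitary:
  assumes A: "A \<in> carrier_mat N N" "mat_adjoint A * A = 1\<^sub>m N"
    and v: "v \<in> carrier_vec N" and w: "w \<in> carrier_vec N"
  shows "cinner (A *\<^sub>v v) (A *\<^sub>v w) = cinner v w"
proof -
  have "cinner (A *\<^sub>v v) (A *\<^sub>v w) = (\<Sum>l<N. cnj ((A *\<^sub>v v) $ l) * (A *\<^sub>v w) $ l)"
    using A by (simp add: cinner_def del: index_mult_mat_vec)
  also have "\<dots> = (\<Sum>l<N. \<Sum>i<N. cnj (v $ i) * (cnj (A $$ (l, i)) * (A *\<^sub>v w) $ l))"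
    by (intro sum.cong refl)
       (simp add: index_mult_mat_vec_sum[OF A(1) v] sum_distrib_left mult_ac del: index_mult_mat_vec)
  also have "\<dots> = (\<Sum>i<N. cnj (v $ i) * (\<Sum>l<N. cnj (A $$ (l, i)) * (A *\<^sub>v w) $ l))"
    by (subst sum.swap) (simp add: sum_distrib_left)
  also have "\<dots> = (\<Sum>i<N. cnj (v $ i) * (mat_adjoint A *\<^sub>v (A *\<^sub>v w)) $ i)"
    using A(1) w
    by (intro sum.cong refl)
       (simp add: index_mult_mat_vec_sum[of "mat_adjoint A" N N] index_mat_adjoint del: index_mult_mat_vec)
  also have "mat_adjoint A *\<^sub>v (A *\<^sub>v w) = w"
    using A w assoc_mult_mat_vec[of "mat_adjoint A" N N A N w] by simp
  finally show ?thesis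
    using v by (simp add: cinner_def)
qed

section \<open>Isotypic decomposition\<close>

locale z2_rep =
  fixes n m :: nat and U :: "nat \<Rightarrow> complex mat"
  assumes rep_carrier: "\<And>g. g < 2^m \<Longrightarrow> U g \<in> carrier_mat (2^n) (2^n)"
    and rep_zero: "U 0 = 1\<^sub>m (2^n)"
    and rep_xor: "\<And>g h. g < 2^m \<Longrightarrow> h < 2^m \<Longrightarrow> U (Bit_Operations.xor g h) = U g * U h"
begin

lemma rep_xor_mult_vec:
  assumes "g < 2^m" "h < 2^m" "v \<in> carrier_vec (2^n)"
  shows "U g *\<^sub>v (U h *\<^sub>v v) = U (Bit_Operations.xor g h) *\<^sub>v v"
  using assms rep_xor rep_carrier assoc_mult_mat_vec[of "U g" "2^n" "2^n" "U h" "2^n" v] by simp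

lemma rep_mult_vec_carrier [simp]:
  "g < 2^m \<Longrightarrow> v \<in> carrier_vec (2^n) \<Longrightarrow> U g *\<^sub>v v \<in> carrier_vec (2^n)"
  by (rule mult_mat_vec_carrier[OF rep_carrier])

lemma char_proj_carrier: "char_proj n m U \<chi> \<in> carrier_mat (2^n) (2^n)"
  by (simp add: char_proj_def)

lemma char_proj_mult_vec:
  assumes v: "v \<in> carrier_vec (2^n)"
  shows "char_proj n m U \<chi> *\<^sub>v v = vec (2^n) (\<lambda>t. \<Sum>g<2^m. \<chi> g / 2^m * (U g *\<^sub>v v) $ t)"
proof
  fix i
  assume "i < dim_vec (vec (2^n) (\<lambda>t. \<Sum>g<2^m. \<chi> g / 2^m * (U g *\<^sub>v v) $ t))"
  then have i: "i < 2^n"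
    by simp
  have "(char_proj n m U \<chi> *\<^sub>v v) $ i
      = (\<Sum>j<2^n. \<Sum>g<2^m. \<chi> g / 2^m * (U g $$ (i, j) * v $ j))"
    unfolding index_mult_mat_vec_sum[OF char_proj_carrier v i] using i
    by (intro sum.cong refl)
       (simp add: char_proj_def sum_divide_distrib sum_distrib_left sum_distrib_right mult_ac)
  also have "\<dots> = (\<Sum>g<2^m. \<Sum>j<2^n. \<chi> g / 2^m * (U g $$ (i, j) * v $ j))"
    by (rule sum.swap)
  also have "\<dots> = (\<Sum>g<2^m. \<chi> g / 2^m * (U g *\<^sub>v v) $ i)"
    by (intro sum.cong refl)
       (simp add: index_mult_mat_vec_sum[OF rep_carrier v i] sum_distrib_left del: index_mult_mat_vec)
  finally show "(char_proj n m U \<chi> *\<^sub>v v) $ i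
      = vec (2^n) (\<lambda>t. \<Sum>g<2^m. \<chi> g / 2^m * (U g *\<^sub>v v) $ t) $ i"
    using i by simp
qed (simp add: char_proj_def)

text \<open>Absorbing \<open>U h\<close> shifts the summation index by \<open>h\<close>; undoing the
  shift turns \<open>\<chi> g\<close> into \<open>\<chi> (xor h g)\<close>, which releases the
  factor \<open>\<chi> h\<close>.\<close>

lemma rep_mult_char_proj:
  assumes \<chi>: "\<chi> \<in> chars m" and v: "v \<in> carrier_vec (2^n)" and h: "h < 2^m"
  shows "U h *\<^sub>v (char_proj n m U \<chi> *\<^sub>v v) = \<chi> h \<cdot>\<^sub>v (char_proj n m U \<chi> *\<^sub>v v)"
proof -
  have "U h *\<^sub>v (char_proj n m U \<chi> *\<^sub>v v)
      = vec (2^n) (\<lambda>t. \<Sum>g<2^m. \<chi> g / 2^m * (U h *\<^sub>v (U g *\<^sub>v v)) $ t)"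
    unfolding char_proj_mult_vec[OF v]
    by (rule mult_mat_vec_vec_sum[OF rep_carrier[OF h]]) (simp add: v)
  also have "\<dots> = vec (2^n) (\<lambda>t. \<Sum>g<2^m. \<chi> g / 2^m * (U (Bit_Operations.xor h g) *\<^sub>v v) $ t)"
    by (simp add: rep_xor_mult_vec[OF h _ v] del: index_mult_mat_vec)
  also have "\<dots> = vec (2^n) (\<lambda>t. \<Sum>g<2^m. \<chi> h * (\<chi> g / 2^m * (U g *\<^sub>v v) $ t))"
  proof (intro arg_cong[where f = "vec (2^n)"] ext)
    fix t
    show "(\<Sum>g<2^m. \<chi> g / 2^m * (U (Bit_Operations.xor h g) *\<^sub>v v) $ t)
        = (\<Sum>g<2^m. \<chi> h * (\<chi> g / 2^m * (U g *\<^sub>v v) $ t))"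
      by (subst sum_xor_reindex[OF h, symmetric])
         (simp add: chars_xor[OF \<chi> h] mult_ac del: index_mult_mat_vec)
  qed
  also have "\<dots> = \<chi> h \<cdot>\<^sub>v (char_proj n m U \<chi> *\<^sub>v v)"
    unfolding char_proj_mult_vec[OF v] by (auto simp: sum_distrib_left simp del: index_mult_mat_vec)
  finally show ?thesis .
qed

text \<open>Each of the \<open>2^m\<close> terms of the average equals \<open>v / 2^m\<close>: the
  eigenvalue meets the same character value and squares to 1.\<close>

lemma char_proj_fixes:
  assumes \<chi>: "\<chi> \<in> chars m" and v: "v \<in> carrier_vec (2^n)"
    and eig: "\<And>g. g < 2^m \<Longrightarrow> U g *\<^sub>v v = \<chi> g \<cdot>\<^sub>v v"
  shows "char_proj n m U \<chi> *\<^sub>v v = v"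
proof -
  have "(\<Sum>g<2^m. \<chi> g / 2^m * (U g *\<^sub>v v) $ t) = v $ t" if t: "t < 2^n" for t
  proof -
    have "(\<Sum>g<2^m. \<chi> g / 2^m * (U g *\<^sub>v v) $ t) = (\<Sum>g<(2::nat)^m. v $ t / 2^m)"
    proof (intro sum.cong refl)
      fix g :: nat
      assume "g \<in> {..<2^m}"
      then have "(U g *\<^sub>v v) $ t = \<chi> g * v $ t"
        using eig[of g] t v by simp
      then have "\<chi> g / 2^m * (U g *\<^sub>v v) $ t = (\<chi> g * \<chi> g) * v $ t / 2^m"
        by simp
      then show "\<chi> g / 2^m * (U g *\<^sub>v v) $ t = v $ t / 2^m"
        by (simp only: chars_square[OF \<chi>] mult_1)
    qed
    then show ?thesis
      by simp
  qed
  then show ?thesis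
    unfolding char_proj_mult_vec[OF v] using v by (auto simp del: index_mult_mat_vec)
qed

text \<open>Joins the two preceding facts: the range of the projector is a joint eigenspace.
  Membership is tested below by eigenvalue equations instead of preimages.\<close>

lemma mem_char_space_iff:
  assumes "\<chi> \<in> chars m"
  shows "v \<in> char_space n m U \<chi> \<longleftrightarrow>
    v \<in> carrier_vec (2^n) \<and> (\<forall>g<2^m. U g *\<^sub>v v = \<chi> g \<cdot>\<^sub>v v)"
proof
  assume "v \<in> char_space n m U \<chi>"
  then show "v \<in> carrier_vec (2^n) \<and> (\<forall>g<2^m. U g *\<^sub>v v = \<chi> g \<cdot>\<^sub>v v)"
    using rep_mult_char_proj[OF assms] mult_mat_vec_carrier[OF char_proj_carrier]
    by (auto simp: char_space_def)
next
  assume "v \<in> carrier_vec (2^n) \<and> (\<forall>g<2^m. U g *\<^sub>v v = \<chi> g \<cdot>\<^sub>v v)"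
  then show "v \<in> char_space n m U \<chi>"
    unfolding char_space_def using char_proj_fixes[OF assms, of v] by (metis image_eqI)
qed

lemma char_space_carrier:
  "\<chi> \<in> chars m \<Longrightarrow> v \<in> char_space n m U \<chi> \<Longrightarrow> v \<in> carrier_vec (2^n)"
  by (simp add: mem_char_space_iff)

lemma sum_char_proj:
  assumes v: "v \<in> carrier_vec (2^n)"
  shows "v = vec (2^n) (\<lambda>t. \<Sum>\<chi>\<in>chars m. (char_proj n m U \<chi> *\<^sub>v v) $ t)"
proof
  fix t
  assume "t < dim_vec (vec (2^n) (\<lambda>t. \<Sum>\<chi>\<in>chars m. (char_proj n m U \<chi> *\<^sub>v v) $ t))"
  then have t: "t < 2^n"
    by simp
  have "(\<Sum>\<chi>\<in>chars m. (char_proj n m U \<chi> *\<^sub>v v) $ t)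
      = (\<Sum>\<chi>\<in>chars m. \<Sum>g<2^m. \<chi> g * ((U g *\<^sub>v v) $ t / 2^m))"
    using t by (simp add: char_proj_mult_vec[OF v] del: index_mult_mat_vec)
  \<comment> \<open>The factor \<open>\<chi> 0 = 1\<close> is inserted so that column orthogonality
    at 0 applies; only the term of \<open>U 0\<close>, the identity, survives.\<close>
  also have "\<dots> = (\<Sum>g<2^m. (\<Sum>\<chi>\<in>chars m. \<chi> g * \<chi> 0) * ((U g *\<^sub>v v) $ t / 2^m))"
    by (subst sum.swap) (simp add: sum_distrib_right sum_divide_distrib del: index_mult_mat_vec)
  also have "\<dots> = (\<Sum>g<2^m. if g = 0 then (U g *\<^sub>v v) $ t else 0)"
    by (intro sum.cong refl)
       (simp add: char_column_orthogonality[of _ m 0] del: index_mult_mat_vec chars_zero)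
  also have "\<dots> = v $ t"
    using v by (simp add: rep_zero del: index_mult_mat_vec)
  finally show "v $ t = vec (2^n) (\<lambda>t. \<Sum>\<chi>\<in>chars m. (char_proj n m U \<chi> *\<^sub>v v) $ t) $ t"
    using t by simp
qed (use v in simp)

text \<open>Applying \<open>U g\<close> to the vanishing sum weights each component by
  \<open>\<chi> g\<close>. Summing these relations over all \<open>g\<close> against
  \<open>\<xi>\<close> isolates, by orthogonality, the component of charge
  \<open>\<xi>\<close>.\<close>

lemma char_spaces_independent:
  assumes u: "\<And>\<chi>. \<chi> \<in> chars m \<Longrightarrow> u \<chi> \<in> char_space n m U \<chi>"
    and zero: "vec (2^n) (\<lambda>t. \<Sum>\<chi>\<in>chars m. u \<chi> $ t) = 0\<^sub>v (2^n)"
    and \<xi>: "\<xi> \<in> chars m"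
  shows "u \<xi> = 0\<^sub>v (2^n)"
proof -
  have carrier: "u \<chi> \<in> carrier_vec (2^n)" if "\<chi> \<in> chars m" for \<chi>
    using u that char_space_carrier by blast
  have twisted: "(\<Sum>\<chi>\<in>chars m. \<chi> g * u \<chi> $ t) = 0" if g: "g < 2^m" and t: "t < 2^n" for g t
  proof -
    have "(\<Sum>\<chi>\<in>chars m. \<chi> g * u \<chi> $ t)
        = vec (2^n) (\<lambda>t. \<Sum>\<chi>\<in>chars m. 1 * (U g *\<^sub>v u \<chi>) $ t) $ t"
    proof -
      have "(U g *\<^sub>v u \<chi>) $ t = \<chi> g * u \<chi> $ t" if "\<chi> \<in> chars m" for \<chi>
        using u[OF that] that g t carrier[OF that] by (simp add: mem_char_space_iff del: index_mult_mat_vec)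
      then show ?thesis
        using t by (simp del: index_mult_mat_vec)
    qed
    also have "vec (2^n) (\<lambda>t. \<Sum>\<chi>\<in>chars m. 1 * (U g *\<^sub>v u \<chi>) $ t)
        = U g *\<^sub>v vec (2^n) (\<lambda>t. \<Sum>\<chi>\<in>chars m. 1 * u \<chi> $ t)"
      by (rule mult_mat_vec_vec_sum[OF rep_carrier[OF g] carrier, symmetric])
    also have "\<dots> = U g *\<^sub>v 0\<^sub>v (2^n)"
      by (simp add: zero)
    also have "\<dots> $ t = 0"
      using rep_carrier[OF g] t by simp
    finally show ?thesis .
  qed
  show ?thesis
  proof
    fix t
    assume "t < dim_vec (0\<^sub>v (2^n))"
    then have t: "t < 2^n"
      by simp
    have "0 = (\<Sum>g<2^m. \<xi> g * (\<Sum>\<chi>\<in>chars m. \<chi> g * u \<chi> $ t))"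
      using twisted t by simp
    also have "\<dots> = (\<Sum>\<chi>\<in>chars m. (\<Sum>g<2^m. \<xi> g * \<chi> g) * u \<chi> $ t)"
      unfolding sum_distrib_left sum_distrib_right by (subst sum.swap) (simp add: mult_ac)
    also have "\<dots> = (\<Sum>\<chi>\<in>chars m. if \<chi> = \<xi> then 2^m * u \<chi> $ t else 0)"
      using \<xi> by (intro sum.cong refl) (simp add: char_orthogonality)
    also have "\<dots> = 2^m * u \<xi> $ t"
      using \<xi> finite_chars by simp
    finally show "u \<xi> $ t = 0\<^sub>v (2^n) $ t"
      using t by simp
  qed (use carrier[OF \<xi>] in simp)
qed

text \<open>The conjugation relation of \<open>charge_ops\<close>, recast as a commutation relation
  for unitaries in general: frame operators carry an arbitrary phase and so may leave the Pauli
  group.\<close>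

definition charged :: "(nat \<Rightarrow> complex) \<Rightarrow> complex mat \<Rightarrow> bool" where
  "charged \<chi> A \<longleftrightarrow> A \<in> carrier_mat (2^n) (2^n) \<and> mat_adjoint A * A = 1\<^sub>m (2^n) \<and>
     (\<forall>g<2^m. U g * A = \<chi> g \<cdot>\<^sub>m (A * U g))"

lemma charged_maps_pn_space:
  assumes \<chi>: "\<chi> \<in> chars m" and A: "charged \<chi> A" and \<psi>: "\<psi> \<in> pn_space n m U"
  shows "A *\<^sub>v \<psi> \<in> char_space n m U \<chi>"
proof -
  have Ac: "A \<in> carrier_mat (2^n) (2^n)"
    using A by (simp add: charged_def)
  have \<psi>c: "\<psi> \<in> carrier_vec (2^n)"
    using \<psi> by (simp add: mem_char_space_iff)
  have "U g *\<^sub>v (A *\<^sub>v \<psi>) = \<chi> g \<cdot>\<^sub>v (A *\<^sub>v \<psi>)" if g: "g < 2^m" for g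
  proof -
    have "U g *\<^sub>v (A *\<^sub>v \<psi>) = (U g * A) *\<^sub>v \<psi>"
      using assoc_mult_mat_vec[OF rep_carrier[OF g] Ac \<psi>c] by simp
    also have "\<dots> = (\<chi> g \<cdot>\<^sub>m (A * U g)) *\<^sub>v \<psi>"
      using A g by (simp add: charged_def)
    also have "\<dots> = \<chi> g \<cdot>\<^sub>v ((A * U g) *\<^sub>v \<psi>)"
      using Ac rep_carrier[OF g] \<psi>c by (intro smult_mat_mult_vec) auto
    also have "(A * U g) *\<^sub>v \<psi> = A *\<^sub>v (U g *\<^sub>v \<psi>)"
      by (rule assoc_mult_mat_vec[OF Ac rep_carrier[OF g] \<psi>c])
    also have "U g *\<^sub>v \<psi> = \<psi>"
      using \<psi> g by (simp add: mem_char_space_iff)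
    finally show ?thesis .
  qed
  then show ?thesis
    using mult_mat_vec_carrier[OF Ac \<psi>c] by (simp add: mem_char_space_iff \<chi>)
qed

text \<open>A left inverse of a square matrix is also a right inverse.\<close>

lemma charged_adjoint_inverse:
  assumes "charged \<chi> A" and v: "v \<in> carrier_vec (2^n)"
  shows "A *\<^sub>v (mat_adjoint A *\<^sub>v v) = v" "mat_adjoint A *\<^sub>v (A *\<^sub>v v) = v"
proof -
  have A: "A \<in> carrier_mat (2^n) (2^n)" "mat_adjoint A * A = 1\<^sub>m (2^n)"
    using assms by (auto simp: charged_def)
  note A' = mat_adjoint_carrier[OF A(1)]
  show "A *\<^sub>v (mat_adjoint A *\<^sub>v v) = v"
    using assoc_mult_mat_vec[OF A(1) A' v] mat_mult_left_right_inverse[OF A' A(1) A(2)] v by simp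
  show "mat_adjoint A *\<^sub>v (A *\<^sub>v v) = v"
    using assoc_mult_mat_vec[OF A' A(1) v] A(2) v by simp
qed

lemma charged_adjoint_maps_char_space:
  assumes \<chi>: "\<chi> \<in> chars m" and A: "charged \<chi> A" and v: "v \<in> char_space n m U \<chi>"
  shows "mat_adjoint A *\<^sub>v v \<in> pn_space n m U"
proof -
  have Ac: "A \<in> carrier_mat (2^n) (2^n)"
    using A by (simp add: charged_def)
  note A' = mat_adjoint_carrier[OF Ac]
  have vc: "v \<in> carrier_vec (2^n)"
    using v \<chi> by (simp add: mem_char_space_iff)
  let ?w = "mat_adjoint A *\<^sub>v v"
  have w: "?w \<in> carrier_vec (2^n)"
    by (rule mult_mat_vec_carrier[OF A' vc])
  have "U g *\<^sub>v ?w = ?w" if g: "g < 2^m" for g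
  proof -
    have "\<chi> g \<cdot>\<^sub>v v = U g *\<^sub>v v"
      using v \<chi> g by (simp add: mem_char_space_iff)
    also have "\<dots> = U g *\<^sub>v (A *\<^sub>v ?w)"
      by (simp add: charged_adjoint_inverse[OF A vc])
    also have "\<dots> = (U g * A) *\<^sub>v ?w"
      using assoc_mult_mat_vec[OF rep_carrier[OF g] Ac w] by simp
    also have "\<dots> = (\<chi> g \<cdot>\<^sub>m (A * U g)) *\<^sub>v ?w"
      using A g by (simp add: charged_def)
    also have "\<dots> = \<chi> g \<cdot>\<^sub>v ((A * U g) *\<^sub>v ?w)"
      using Ac rep_carrier[OF g] w by (intro smult_mat_mult_vec) auto
    also have "(A * U g) *\<^sub>v ?w = A *\<^sub>v (U g *\<^sub>v ?w)"
      by (rule assoc_mult_mat_vec[OF Ac rep_carrier[OF g] w])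
    \<comment> \<open>The factor \<open>\<chi> g\<close> is removed by multiplying with it once
      more, since its square is 1.\<close>
    finally have "\<chi> g \<cdot>\<^sub>v (\<chi> g \<cdot>\<^sub>v v) = \<chi> g \<cdot>\<^sub>v (\<chi> g \<cdot>\<^sub>v (A *\<^sub>v (U g *\<^sub>v ?w)))"
      by simp
    then have "v = A *\<^sub>v (U g *\<^sub>v ?w)"
      by (simp add: smult_smult_assoc chars_square[OF \<chi>])
    then show ?thesis
      using charged_adjoint_inverse(2)[OF A rep_mult_vec_carrier[OF g w]] by simp
  qed
  then show ?thesis
    using w by (simp add: mem_char_space_iff)
qed

lemma charged_image_pn_space:
  assumes \<chi>: "\<chi> \<in> chars m" and A: "charged \<chi> A"
  shows "(\<lambda>\<psi>. A *\<^sub>v \<psi>) ` pn_space n m U = char_space n m U \<chi>"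
proof
  show "char_space n m U \<chi> \<subseteq> (\<lambda>\<psi>. A *\<^sub>v \<psi>) ` pn_space n m U"
  proof
    fix v
    assume v: "v \<in> char_space n m U \<chi>"
    then have "v = A *\<^sub>v (mat_adjoint A *\<^sub>v v)"
      using charged_adjoint_inverse(1)[OF A] char_space_carrier[OF \<chi>] by simp
    then show "v \<in> (\<lambda>\<psi>. A *\<^sub>v \<psi>) ` pn_space n m U"
      using charged_adjoint_maps_char_space[OF \<chi> A v] by blast
  qed
qed (use charged_maps_pn_space[OF \<chi> A] in blast)

text \<open>Two operators of the same charge differ on the code space by \<open>A\<^sup>\<dagger>B\<close>, which preserves it, so
  the Knill-Laflamme condition forces them to agree there up to a scalar.\<close>

lemma charged_proportional:
  assumes \<chi>: "\<chi> \<in> chars m" and A: "charged \<chi> A" and B: "charged \<chi> B"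
    and corr: "pn_proj n m U * (mat_adjoint A * B) * pn_proj n m U = c \<cdot>\<^sub>m pn_proj n m U"
  shows "\<exists>\<eta>. cmod \<eta> = 1 \<and> (\<forall>\<psi>\<in>pn_space n m U. B *\<^sub>v \<psi> = \<eta> \<cdot>\<^sub>v (A *\<^sub>v \<psi>))"
proof -
  let ?P = "pn_proj n m U"
  have Ac: "A \<in> carrier_mat (2^n) (2^n)" and Bc: "B \<in> carrier_mat (2^n) (2^n)"
    and Au: "mat_adjoint A * A = 1\<^sub>m (2^n)" and Bu: "mat_adjoint B * B = 1\<^sub>m (2^n)"
    using A B by (auto simp: charged_def)
  note A' = mat_adjoint_carrier[OF Ac]
  have proj_pn: "?P *\<^sub>v \<psi> = \<psi>" if "\<psi> \<in> pn_space n m U" for \<psi>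
    using char_proj_fixes[OF triv_char_in_chars, of \<psi>] that mem_char_space_iff[OF triv_char_in_chars]
    by blast
  have eq_on_pn: "B *\<^sub>v \<psi> = c \<cdot>\<^sub>v (A *\<^sub>v \<psi>)" if \<psi>: "\<psi> \<in> pn_space n m U" for \<psi>
  proof -
    have \<psi>c: "\<psi> \<in> carrier_vec (2^n)"
      using \<psi> by (simp add: mem_char_space_iff)
    note B\<psi> = charged_maps_pn_space[OF \<chi> B \<psi>]
    note B\<psi>c = mult_mat_vec_carrier[OF Bc \<psi>c]
    \<comment> \<open>Both \<open>\<psi>\<close> and
      \<open>mat_adjoint A *\<^sub>v (B *\<^sub>v \<psi>)\<close> lie in the code space, so the
      projectors can be inserted freely and the Knill-Laflamme equation applies.\<close>
    have "mat_adjoint A *\<^sub>v (B *\<^sub>v \<psi>) = ?P *\<^sub>v (mat_adjoint A *\<^sub>v (B *\<^sub>v (?P *\<^sub>v \<psi>)))"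
      using proj_pn[OF \<psi>] proj_pn[OF charged_adjoint_maps_char_space[OF \<chi> A B\<psi>]] by simp
    also have "\<dots> = (?P * (mat_adjoint A * B) * ?P) *\<^sub>v \<psi>"
    proof -
      have P\<psi>: "?P *\<^sub>v \<psi> \<in> carrier_vec (2^n)"
        by (rule mult_mat_vec_carrier[OF char_proj_carrier \<psi>c])
      have AB: "mat_adjoint A * B \<in> carrier_mat (2^n) (2^n)"
        by (rule mult_carrier_mat[OF A' Bc])
      show ?thesis
        by (simp only: assoc_mult_mat_vec[OF mult_carrier_mat[OF char_proj_carrier AB] char_proj_carrier \<psi>c]
            assoc_mult_mat_vec[OF char_proj_carrier AB P\<psi>] assoc_mult_mat_vec[OF A' Bc P\<psi>])
    qed
    also have "\<dots> = c \<cdot>\<^sub>v \<psi>"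
      unfolding corr using char_proj_carrier[of triv_char] \<psi>c proj_pn[OF \<psi>]
      by (simp add: smult_mat_mult_vec)
    finally have "A *\<^sub>v (mat_adjoint A *\<^sub>v (B *\<^sub>v \<psi>)) = A *\<^sub>v (c \<cdot>\<^sub>v \<psi>)"
      by simp
    then show ?thesis
      using charged_adjoint_inverse(1)[OF A B\<psi>c] mult_mat_vec[OF Ac \<psi>c] by simp
  qed
  show ?thesis
  \<comment> \<open>The modulus of \<open>c\<close> is read off by comparing norms on a vector of
    nonzero norm. If there is none, the code space is zero and the phase 1 serves.\<close>
  proof (cases "\<exists>\<psi>\<in>pn_space n m U. cinner \<psi> \<psi> \<noteq> 0")
    case True
    then obtain \<psi> where \<psi>: "\<psi> \<in> pn_space n m U" and nz: "cinner \<psi> \<psi> \<noteq> 0"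
      by blast
    have \<psi>c: "\<psi> \<in> carrier_vec (2^n)"
      using \<psi> by (simp add: mem_char_space_iff)
    have "cinner \<psi> \<psi> = cinner (c \<cdot>\<^sub>v (A *\<^sub>v \<psi>)) (c \<cdot>\<^sub>v (A *\<^sub>v \<psi>))"
      using cinner_unitary[OF Bc Bu \<psi>c \<psi>c] eq_on_pn[OF \<psi>] by simp
    also have "\<dots> = (cnj c * c) * cinner (A *\<^sub>v \<psi>) (A *\<^sub>v \<psi>)"
      by (simp add: cinner_def sum_distrib_left mult_ac del: index_mult_mat_vec)
    also have "\<dots> = (cnj c * c) * cinner \<psi> \<psi>"
      by (simp add: cinner_unitary[OF Ac Au \<psi>c \<psi>c])
    finally have "cnj c * c = 1"
      using nz by simp
    then have "(complex_of_real (cmod c))\<^sup>2 = 1"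
      using complex_norm_square[of c] by (simp add: mult.commute)
    then have "(cmod c)\<^sup>2 = 1"
      by (metis of_real_eq_1_iff of_real_power)
    then have "cmod c = 1"
      by (simp add: power2_eq_1_iff) (use norm_ge_zero[of c] in linarith)
    then show ?thesis
      using eq_on_pn by blast
  next
    case False
    have "B *\<^sub>v \<psi> = 1 \<cdot>\<^sub>v (A *\<^sub>v \<psi>)" if \<psi>: "\<psi> \<in> pn_space n m U" for \<psi>
    proof -
      have \<psi>c: "\<psi> \<in> carrier_vec (2^n)"
        using \<psi> by (simp add: mem_char_space_iff)
      have "(\<Sum>i<2^n. complex_of_real ((cmod (\<psi> $ i))\<^sup>2)) = cinner \<psi> \<psi>"
        using \<psi>c by (simp add: cinner_def complex_norm_square mult.commute del: of_real_power)
      then have "complex_of_real (\<Sum>i<2^n. (cmod (\<psi> $ i))\<^sup>2) = 0"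
        using False \<psi> by simp
      then have "(\<Sum>i<2^n. (cmod (\<psi> $ i))\<^sup>2) = 0"
        by (simp only: of_real_eq_0_iff)
      then have "\<psi> = 0\<^sub>v (2^n)"
        using \<psi>c by (auto simp: sum_nonneg_eq_0_iff)
      then show ?thesis
        using mult_mat_zero_vec[OF Ac] mult_mat_zero_vec[OF Bc] by simp
    qed
    then show ?thesis
      by (intro exI[of _ 1]) simp
  qed
qed

end

section \<open>The frame-dependent tensor product\<close>

text \<open>For a character, the coefficient of \<open>w\<close> along
  \<open>char_ket m \<chi>\<close>; the square root of the group order makes the transform
  unitary.\<close>

definition fourier :: "nat \<Rightarrow> (nat \<Rightarrow> complex) \<Rightarrow> complex vec \<Rightarrow> complex" where
  "fourier m \<chi> w = (\<Sum>h<2^m. \<chi> h * w $ h) / complex_of_real (sqrt (2^m))"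

definition char_ket :: "nat \<Rightarrow> (nat \<Rightarrow> complex) \<Rightarrow> complex vec" where
  "char_ket m \<chi> = vec (2^m) (\<lambda>g. \<chi> g / complex_of_real (sqrt (2^m)))"

lemma of_real_sqrt_two_power_square [simp]:
  "complex_of_real (sqrt (2^m)) * complex_of_real (sqrt (2^m)) = 2^m"
  by (simp flip: of_real_mult)

lemma char_ket_carrier [simp]: "char_ket m \<chi> \<in> carrier_vec (2^m)"
  by (simp add: char_ket_def)

lemma fourier_char_ket:
  assumes "\<chi> \<in> chars m" "\<chi>' \<in> chars m"
  shows "fourier m \<chi> (char_ket m \<chi>') = (if \<chi> = \<chi>' then 1 else 0)"
proof -
  have "fourier m \<chi> (char_ket m \<chi>') = (\<Sum>h<2^m. \<chi> h * \<chi>' h) / 2^m"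
    by (simp add: fourier_def char_ket_def flip: sum_divide_distrib)
  then show ?thesis
    by (simp add: char_orthogonality[OF assms])
qed

lemma cinner_char_ket:
  assumes "\<chi> \<in> chars m"
  shows "cinner (char_ket m \<chi>) w = fourier m \<chi> w"
  using assms by (simp add: cinner_def fourier_def char_ket_def sum_divide_distrib)

lemma fourier_inversion:
  assumes "w \<in> carrier_vec (2^m)"
  shows "w = vec (2^m) (\<lambda>t. \<Sum>\<chi>\<in>chars m. fourier m \<chi> w * char_ket m \<chi> $ t)"
proof
  fix t
  assume "t < dim_vec (vec (2^m) (\<lambda>t. \<Sum>\<chi>\<in>chars m. fourier m \<chi> w * char_ket m \<chi> $ t))"
  then have t: "t < 2^m"
    by simp
  have "(\<Sum>\<chi>\<in>chars m. fourier m \<chi> w * char_ket m \<chi> $ t)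
      = (\<Sum>\<chi>\<in>chars m. \<Sum>h<2^m. \<chi> h * \<chi> t * (w $ h / 2^m))"
    using t by (simp add: fourier_def char_ket_def sum_distrib_left sum_divide_distrib mult_ac)
  also have "\<dots> = (\<Sum>h<2^m. (\<Sum>\<chi>\<in>chars m. \<chi> h * \<chi> t) * (w $ h / 2^m))"
    unfolding sum_distrib_right by (rule sum.swap)
  also have "\<dots> = (\<Sum>h<2^m. if h = t then w $ h else 0)"
    by (intro sum.cong refl) (use t in \<open>simp add: char_column_orthogonality\<close>)
  also have "\<dots> = w $ t"
    using t by simp
  finally show "w $ t = vec (2^m) (\<lambda>t. \<Sum>\<chi>\<in>chars m. fourier m \<chi> w * char_ket m \<chi> $ t) $ t"
    using t by simp
qed (use assms in simp)

lemma fourier_injective: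
  assumes "w \<in> carrier_vec (2^m)" "\<And>\<chi>. \<chi> \<in> chars m \<Longrightarrow> fourier m \<chi> w = 0"
  shows "w = 0\<^sub>v (2^m)"
  using fourier_inversion[OF assms(1)] assms(2) by (simp add: zero_vec_def)

lemma fourier_linear:
  assumes "w \<in> carrier_vec (2^m)" "v \<in> carrier_vec (2^m)"
  shows "fourier m \<chi> (a \<cdot>\<^sub>v w + v) = a * fourier m \<chi> w + fourier m \<chi> v"
  using assms
  by (simp add: fourier_def algebra_simps sum.distrib sum_distrib_left add_divide_distrib)

lemma fourier_unit_vec:
  assumes "r < 2^m"
  shows "fourier m \<chi> (unit_vec (2^m) r) = \<chi> r / complex_of_real (sqrt (2^m))"
proof -
  have "(\<Sum>h<2^m. \<chi> h * unit_vec (2^m) r $ h) = (\<Sum>h<2^m. if h = r then \<chi> h else 0)"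
    by (intro sum.cong refl) (use assms in simp)
  then show ?thesis
    using assms by (simp add: fourier_def)
qed

text \<open>Gives the transform through its values on the standard basis, the form in which it
  arises when combinations of product basis vectors are expanded.\<close>

lemma fourier_vec_sum:
  "fourier m \<chi> (vec (2^m) f)
    = (\<Sum>r<2^m. f r * fourier m \<chi> (unit_vec (2^m) r))"
  by (simp add: fourier_unit_vec) (simp add: fourier_def sum_divide_distrib mult.commute)

text \<open>Translations are diagonal in the character basis: shifting the summation index moves
  \<open>g\<close> from the vector onto the character.\<close>

lemma fourier_regular_rep:
  assumes \<chi>: "\<chi> \<in> chars m" and g: "g < 2^m" and w: "w \<in> carrier_vec (2^m)"
  shows "fourier m \<chi> (regular_rep m g *\<^sub>v w) = \<chi> g * fourier m \<chi> w"
proof -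
  have "(\<Sum>h<2^m. \<chi> h * (regular_rep m g *\<^sub>v w) $ h)
      = (\<Sum>h<2^m. \<chi> h * w $ (Bit_Operations.xor g h))"
    by (simp add: regular_rep_mult_vec[OF g w] del: index_mult_mat_vec)
  also have "\<dots> = (\<Sum>h<2^m. \<chi> (Bit_Operations.xor g h) * w $ h)"
    by (subst sum_xor_reindex[OF g, symmetric]) simp
  also have "\<dots> = \<chi> g * (\<Sum>h<2^m. \<chi> h * w $ h)"
    by (simp add: chars_xor[OF \<chi> g] sum_distrib_left mult.assoc)
  finally show ?thesis
    by (simp add: fourier_def)
qed

section \<open>Linear combinations over lists indexed by pairs\<close>

lemma length_concat_map_upt:
  "length (concat (map (\<lambda>b. map (f b) [0..<d]) bs)) = length bs * d"
  by (induction bs) auto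

lemma nth_concat_map_upt:
  assumes "q < length bs" "r < d"
  shows "concat (map (\<lambda>b. map (f b) [0..<d]) bs) ! (q * d + r) = f (bs ! q) r"
  using assms
proof (induction bs arbitrary: q)
  case (Cons b bs)
  then show ?case
    by (cases q) (auto simp: nth_append algebra_simps)
qed simp

text \<open>The list consists of rows of length \<open>d\<close>, so the coefficient of the pair
  \<open>(q, r)\<close> sits at position \<open>q * d + r\<close> and the single sum splits into
  blocks.\<close>

lemma lincomb_concat_map_upt:
  "lincomb N c (concat (map (\<lambda>b. map (f b) [0..<d]) bs))
    = vec N (\<lambda>t. \<Sum>q<length bs. \<Sum>r<d. c (q * d + r) * f (bs ! q) r $ t)"
proof -
  have "(\<Sum>i<length bs * d. c i * concat (map (\<lambda>b. map (f b) [0..<d]) bs) ! i $ t)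
      = (\<Sum>q<length bs. \<Sum>r<d. c (q * d + r) * f (bs ! q) r $ t)" for t
  proof -
    have "(\<Sum>i<length bs * d. c i * concat (map (\<lambda>b. map (f b) [0..<d]) bs) ! i $ t)
        = (\<Sum>q<length bs. \<Sum>i = q * d..<q * d + d.
            c i * concat (map (\<lambda>b. map (f b) [0..<d]) bs) ! i $ t)"
      by (rule sum.nat_group[symmetric])
    also have "\<dots> = (\<Sum>q<length bs. \<Sum>r<d. c (q * d + r) * f (bs ! q) r $ t)"
    proof (rule sum.cong[OF refl])
      fix q
      assume q: "q \<in> {..<length bs}"
      have "(\<Sum>i = q * d..<q * d + d. c i * concat (map (\<lambda>b. map (f b) [0..<d]) bs) ! i $ t)
          = (\<Sum>r<d. c (q * d + r) * concat (map (\<lambda>b. map (f b) [0..<d]) bs) ! (q * d + r) $ t)"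
        by (rule sum.reindex_bij_witness[of _ "\<lambda>r. q * d + r" "\<lambda>i. i - q * d"]) auto
      then show "(\<Sum>i = q * d..<q * d + d. c i * concat (map (\<lambda>b. map (f b) [0..<d]) bs) ! i $ t)
          = (\<Sum>r<d. c (q * d + r) * f (bs ! q) r $ t)"
        using q by (simp add: nth_concat_map_upt)
    qed
    finally show ?thesis .
  qed
  then show ?thesis
    by (simp add: lincomb_def length_concat_map_upt)
qed

lemma mult_mat_vec_lincomb:
  assumes "A \<in> carrier_mat N N" "set bs \<subseteq> carrier_vec N"
  shows "A *\<^sub>v lincomb N c bs = vec N (\<lambda>t. \<Sum>q<length bs. c q * (A *\<^sub>v (bs ! q)) $ t)"
  unfolding lincomb_def using assms by (intro mult_mat_vec_vec_sum) auto

section \<open>The tensor product built from one charged operator per character\<close>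

locale charged_frame = z2_rep +
  fixes F :: "(nat \<Rightarrow> complex) \<Rightarrow> complex mat"
  assumes frame_charged: "\<And>\<chi>. \<chi> \<in> chars m \<Longrightarrow> charged \<chi> (F \<chi>)"
begin

text \<open>The bilinear extension of
  \<open>\<psi> \<otimes> |\<chi>> \<mapsto> F \<chi> \<psi>\<close>, obtained by expanding
  \<open>w\<close> in the character basis.\<close>

definition frame_tensor :: "complex vec \<Rightarrow> complex vec \<Rightarrow> complex vec" where
  "frame_tensor \<psi> w = vec (2^n) (\<lambda>t. \<Sum>\<chi>\<in>chars m. fourier m \<chi> w * (F \<chi> *\<^sub>v \<psi>) $ t)"

lemma frame_carrier: "\<chi> \<in> chars m \<Longrightarrow> F \<chi> \<in> carrier_mat (2^n) (2^n)"
  using frame_charged by (simp add: charged_def)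

lemma pn_space_carrier: "\<psi> \<in> pn_space n m U \<Longrightarrow> \<psi> \<in> carrier_vec (2^n)"
  by (simp add: mem_char_space_iff)

lemma frame_tensor_carrier [simp]: "frame_tensor \<psi> w \<in> carrier_vec (2^n)"
  by (simp add: frame_tensor_def)

lemma frame_tensor_char_ket:
  assumes \<chi>: "\<chi> \<in> chars m"
  shows "frame_tensor \<psi> (char_ket m \<chi>) = F \<chi> *\<^sub>v \<psi>"
proof
  fix t
  assume "t < dim_vec (F \<chi> *\<^sub>v \<psi>)"
  then have t: "t < 2^n"
    using frame_carrier[OF \<chi>] by simp
  have "(\<Sum>\<xi>\<in>chars m. fourier m \<xi> (char_ket m \<chi>) * (F \<xi> *\<^sub>v \<psi>) $ t)
      = (\<Sum>\<xi>\<in>chars m. if \<xi> = \<chi> then (F \<xi> *\<^sub>v \<psi>) $ t else 0)"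
    by (intro sum.cong refl) (simp add: fourier_char_ket \<chi> del: index_mult_mat_vec)
  then show "frame_tensor \<psi> (char_ket m \<chi>) $ t = (F \<chi> *\<^sub>v \<psi>) $ t"
    using t \<chi> finite_chars by (simp add: frame_tensor_def del: index_mult_mat_vec)
qed (use frame_carrier[OF \<chi>] in \<open>simp add: frame_tensor_def\<close>)

lemma frame_tensor_linear_left:
  assumes "\<psi> \<in> carrier_vec (2^n)" "\<phi> \<in> carrier_vec (2^n)"
  shows "frame_tensor (a \<cdot>\<^sub>v \<psi> + \<phi>) w = a \<cdot>\<^sub>v frame_tensor \<psi> w + frame_tensor \<phi> w"
proof
  fix t
  assume "t < dim_vec (a \<cdot>\<^sub>v frame_tensor \<psi> w + frame_tensor \<phi> w)"
  then have t: "t < 2^n"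
    by (simp add: frame_tensor_def)
  have "(F \<chi> *\<^sub>v (a \<cdot>\<^sub>v \<psi> + \<phi>)) $ t = a * (F \<chi> *\<^sub>v \<psi>) $ t + (F \<chi> *\<^sub>v \<phi>) $ t" if "\<chi> \<in> chars m" for \<chi>
  proof -
    note Fc = frame_carrier[OF that]
    have "F \<chi> *\<^sub>v (a \<cdot>\<^sub>v \<psi> + \<phi>) = a \<cdot>\<^sub>v (F \<chi> *\<^sub>v \<psi>) + F \<chi> *\<^sub>v \<phi>"
      using assms mult_add_distrib_mat_vec[OF Fc, of "a \<cdot>\<^sub>v \<psi>" \<phi>] mult_mat_vec[OF Fc, of \<psi> a] by simp
    then show ?thesis
      using t Fc by (simp del: index_mult_mat_vec)
  qed
  then show "frame_tensor (a \<cdot>\<^sub>v \<psi> + \<phi>) w $ t = (a \<cdot>\<^sub>v frame_tensor \<psi> w + frame_tensor \<phi> w) $ t"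
    using t
    by (simp add: frame_tensor_def algebra_simps sum.distrib sum_distrib_left del: index_mult_mat_vec)
qed (simp add: frame_tensor_def)

lemma frame_tensor_linear_right:
  assumes "w \<in> carrier_vec (2^m)" "v \<in> carrier_vec (2^m)"
  shows "frame_tensor \<psi> (a \<cdot>\<^sub>v w + v) = a \<cdot>\<^sub>v frame_tensor \<psi> w + frame_tensor \<psi> v"
  by (auto simp: frame_tensor_def fourier_linear[OF assms] algebra_simps sum.distrib sum_distrib_left
      simp del: index_mult_mat_vec)

text \<open>Each summand lies in one charge sector, on which \<open>U g\<close> acts by
  \<open>\<chi> g\<close>; the Fourier coefficient of the translated \<open>w\<close> acquires the
  same factor.\<close>

lemma rep_frame_tensor:
  assumes g: "g < 2^m" and \<psi>: "\<psi> \<in> pn_space n m U" and w: "w \<in> carrier_vec (2^m)"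
  shows "U g *\<^sub>v frame_tensor \<psi> w = frame_tensor \<psi> (regular_rep m g *\<^sub>v w)"
proof -
  have "U g *\<^sub>v frame_tensor \<psi> w
      = vec (2^n) (\<lambda>t. \<Sum>\<chi>\<in>chars m. fourier m \<chi> w * (U g *\<^sub>v (F \<chi> *\<^sub>v \<psi>)) $ t)"
    unfolding frame_tensor_def
    by (rule mult_mat_vec_vec_sum[OF rep_carrier[OF g]])
       (rule mult_mat_vec_carrier[OF frame_carrier pn_space_carrier[OF \<psi>]])
  also have "\<dots> = frame_tensor \<psi> (regular_rep m g *\<^sub>v w)"
  proof -
    have "fourier m \<chi> w * (U g *\<^sub>v (F \<chi> *\<^sub>v \<psi>)) $ t
        = fourier m \<chi> (regular_rep m g *\<^sub>v w) * (F \<chi> *\<^sub>v \<psi>) $ t"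
      if \<chi>: "\<chi> \<in> chars m" and t: "t < 2^n" for \<chi> t
    proof -
      have "U g *\<^sub>v (F \<chi> *\<^sub>v \<psi>) = \<chi> g \<cdot>\<^sub>v (F \<chi> *\<^sub>v \<psi>)"
        using charged_maps_pn_space[OF \<chi> frame_charged[OF \<chi>] \<psi>] g by (simp add: mem_char_space_iff[OF \<chi>])
      then show ?thesis
        using t frame_carrier[OF \<chi>]
        by (simp add: fourier_regular_rep[OF \<chi> g w] del: index_mult_mat_vec)
    qed
    then show ?thesis
      unfolding frame_tensor_def by (intro eq_vecI) (auto simp del: index_mult_mat_vec)
  qed
  finally show ?thesis .
qed

text \<open>Regroups a combination of product vectors by charge. Row \<open>q\<close> of the
  coefficients is a vector on the group, and its Fourier coefficient at \<open>\<chi>\<close>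
  becomes the coefficient of \<open>bs ! q\<close> in the state to which \<open>F \<chi>\<close> is
  applied.\<close>

lemma lincomb_frame_tensor_basis:
  assumes bs: "set bs \<subseteq> carrier_vec (2^n)"
  shows "lincomb (2^n) c (concat (map (\<lambda>b. map (\<lambda>j. frame_tensor b (unit_vec (2^m) j)) [0..<2^m]) bs))
    = vec (2^n) (\<lambda>t. \<Sum>\<chi>\<in>chars m.
        (F \<chi> *\<^sub>v lincomb (2^n) (\<lambda>q. fourier m \<chi> (vec (2^m) (\<lambda>r. c (q * 2^m + r)))) bs) $ t)"
  (is "?L = ?R")
proof
  fix t
  assume "t < dim_vec ?R"
  then have t: "t < 2^n"
    by simp
  have "?L $ t = (\<Sum>q<length bs. \<Sum>r<2^m. \<Sum>\<chi>\<in>chars m.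
      c (q * 2^m + r) * fourier m \<chi> (unit_vec (2^m) r) * (F \<chi> *\<^sub>v (bs ! q)) $ t)"
    using t unfolding lincomb_concat_map_upt
    by (simp add: frame_tensor_def sum_distrib_left mult.assoc del: index_mult_mat_vec)
  also have "\<dots> = (\<Sum>q<length bs. \<Sum>\<chi>\<in>chars m. \<Sum>r<2^m.
      c (q * 2^m + r) * fourier m \<chi> (unit_vec (2^m) r) * (F \<chi> *\<^sub>v (bs ! q)) $ t)"
    by (intro sum.cong refl sum.swap)
  also have "\<dots> = (\<Sum>\<chi>\<in>chars m. \<Sum>q<length bs.
      fourier m \<chi> (vec (2^m) (\<lambda>r. c (q * 2^m + r))) * (F \<chi> *\<^sub>v (bs ! q)) $ t)"
    by (subst sum.swap) (simp add: fourier_vec_sum sum_distrib_right del: index_mult_mat_vec)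
  also have "\<dots> = ?R $ t"
    using t by (simp add: mult_mat_vec_lincomb[OF frame_carrier bs] del: index_mult_mat_vec)
  finally show "?L $ t = ?R $ t" .
qed (simp add: lincomb_def)

lemma lincomb_in_pn_space:
  assumes bs: "set bs \<subseteq> pn_space n m U"
  shows "lincomb (2^n) c bs \<in> pn_space n m U"
proof -
  have bsc: "set bs \<subseteq> carrier_vec (2^n)"
    using bs pn_space_carrier by blast
  have "U g *\<^sub>v lincomb (2^n) c bs = lincomb (2^n) c bs" if g: "g < 2^m" for g
  proof -
    have "U g *\<^sub>v (bs ! q) = bs ! q" if "q < length bs" for q
    proof -
      have "bs ! q \<in> pn_space n m U"
        using bs that nth_mem by blast
      then show ?thesis
        using g pn_space_carrier[of "bs ! q"] by (simp add: mem_char_space_iff)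
    qed
    then show ?thesis
      unfolding mult_mat_vec_lincomb[OF rep_carrier[OF g] bsc]
      by (simp add: lincomb_def del: index_mult_mat_vec)
  qed
  then show ?thesis
    by (simp add: mem_char_space_iff) (simp add: lincomb_def)
qed

text \<open>Independence: the sectors are independent, each \<open>F \<chi>\<close> is injective,
  \<open>bs\<close> is independent and the Fourier transform is injective, so the coefficients
  vanish in turn. Spanning: each sector component of \<open>v\<close> is pulled back to the code
  space and expanded in \<open>bs\<close>, and the coefficients are transformed back.\<close>

lemma frame_tensor_basis:
  assumes "is_basis_list (2^n) (pn_space n m U) bs"
  shows "is_basis_list (2^n) (carrier_vec (2^n))
    (concat (map (\<lambda>b. map (\<lambda>j. frame_tensor b (unit_vec (2^m) j)) [0..<2^m]) bs))"
    (is "is_basis_list _ _ ?ts")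
proof -
  have bs: "set bs \<subseteq> pn_space n m U"
    and indep: "\<And>c i. lincomb (2^n) c bs = 0\<^sub>v (2^n) \<Longrightarrow> i < length bs \<Longrightarrow> c i = 0"
    and span: "\<And>v. v \<in> pn_space n m U \<Longrightarrow> \<exists>c. v = lincomb (2^n) c bs"
    using assms by (auto simp: is_basis_list_def)
  have bsc: "set bs \<subseteq> carrier_vec (2^n)"
    using bs pn_space_carrier by blast
  have len: "length ?ts = length bs * 2^m"
    by (rule length_concat_map_upt)
  have "c i = 0" if zero: "lincomb (2^n) c ?ts = 0\<^sub>v (2^n)" and i: "i < length ?ts" for c i
  proof -
    let ?w = "\<lambda>q. vec (2^m) (\<lambda>r. c (q * 2^m + r))"
    let ?\<phi> = "\<lambda>\<chi>. lincomb (2^n) (\<lambda>q. fourier m \<chi> (?w q)) bs"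
    have "fourier m \<chi> (?w q) = 0" if \<chi>: "\<chi> \<in> chars m" and q: "q < length bs" for \<chi> q
    proof -
      have "F \<chi> *\<^sub>v ?\<phi> \<chi> = 0\<^sub>v (2^n)"
      proof (rule char_spaces_independent[OF _ _ \<chi>])
        show "F \<xi> *\<^sub>v ?\<phi> \<xi> \<in> char_space n m U \<xi>" if "\<xi> \<in> chars m" for \<xi>
          using that by (intro charged_maps_pn_space frame_charged lincomb_in_pn_space bs)
        show "vec (2^n) (\<lambda>t. \<Sum>\<xi>\<in>chars m. (F \<xi> *\<^sub>v ?\<phi> \<xi>) $ t) = 0\<^sub>v (2^n)"
          using zero unfolding lincomb_frame_tensor_basis[OF bsc] .
      qed
      moreover have "?\<phi> \<chi> \<in> carrier_vec (2^n)"
        by (simp add: lincomb_def)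
      ultimately have "?\<phi> \<chi> = mat_adjoint (F \<chi>) *\<^sub>v 0\<^sub>v (2^n)"
        using charged_adjoint_inverse(2)[OF frame_charged[OF \<chi>]] by metis
      also have "\<dots> = 0\<^sub>v (2^n)"
        by (rule mult_mat_zero_vec[OF mat_adjoint_carrier[OF frame_carrier[OF \<chi>]]])
      finally show ?thesis
        using indep q by blast
    qed
    then have w: "?w q = 0\<^sub>v (2^m)" if "q < length bs" for q
      using that by (intro fourier_injective) auto
    \<comment> \<open>Quotient and remainder invert the indexing \<open>q * 2^m + r\<close>.\<close>
    have "i div 2^m < length bs"
      using i len by (simp add: less_mult_imp_div_less)
    from w[OF this] have "?w (i div 2^m) $ (i mod 2^m) = 0"
      by simp
    then show "c i = 0"
      by (simp add: div_mult_mod_eq)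
  qed
  moreover have "\<exists>c. v = lincomb (2^n) c ?ts" if v: "v \<in> carrier_vec (2^n)" for v
  proof -
    \<comment> \<open>The code state that \<open>F \<chi>\<close> sends to the charge
      \<open>\<chi>\<close> component of \<open>v\<close>.\<close>
    let ?\<phi> = "\<lambda>\<chi>. mat_adjoint (F \<chi>) *\<^sub>v (char_proj n m U \<chi> *\<^sub>v v)"
    have "\<exists>a. ?\<phi> \<chi> = lincomb (2^n) a bs" if "\<chi> \<in> chars m" for \<chi>
      using that v
      by (intro span charged_adjoint_maps_char_space) (auto simp: char_space_def frame_charged)
    then obtain a where a: "\<And>\<chi>. \<chi> \<in> chars m \<Longrightarrow> ?\<phi> \<chi> = lincomb (2^n) (a \<chi>) bs"
      by metis
    \<comment> \<open>\<open>w q\<close> is built to have Fourier coefficients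
      \<open>a \<chi> q\<close>; its entries fill row \<open>q\<close> of the coefficient function
      \<open>c\<close>.\<close>
    define w where "w q = vec (2^m) (\<lambda>t. \<Sum>\<chi>\<in>chars m. a \<chi> q * char_ket m \<chi> $ t)" for q
    define c where "c i = w (i div 2^m) $ (i mod 2^m)" for i
    have four: "fourier m \<xi> (w q) = a \<xi> q" if \<xi>: "\<xi> \<in> chars m" for \<xi> q
    proof -
      have "fourier m \<xi> (w q) = (\<Sum>\<chi>\<in>chars m. a \<chi> q * fourier m \<xi> (char_ket m \<chi>))"
        unfolding fourier_def w_def
        by (simp add: sum_distrib_left sum_divide_distrib mult_ac) (rule sum.swap)
      also have "\<dots> = (\<Sum>\<chi>\<in>chars m. if \<chi> = \<xi> then a \<chi> q else 0)"
        by (intro sum.cong refl) (simp add: fourier_char_ket \<xi>)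
      finally show ?thesis
        using \<xi> finite_chars by simp
    qed
    have wc: "vec (2^m) (\<lambda>r. c (q * 2^m + r)) = w q" for q
      by (auto simp: c_def w_def)
    have "lincomb (2^n) c ?ts = vec (2^n) (\<lambda>t. \<Sum>\<chi>\<in>chars m. (F \<chi> *\<^sub>v ?\<phi> \<chi>) $ t)"
      unfolding lincomb_frame_tensor_basis[OF bsc] wc
      by (simp add: four a del: index_mult_mat_vec)
    also have "\<dots> = vec (2^n) (\<lambda>t. \<Sum>\<chi>\<in>chars m. (char_proj n m U \<chi> *\<^sub>v v) $ t)"
      using charged_adjoint_inverse(1)[OF frame_charged] mult_mat_vec_carrier[OF char_proj_carrier v]
      by (simp del: index_mult_mat_vec)
    also have "\<dots> = v"
      by (rule sum_char_proj[OF v, symmetric])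
    finally show ?thesis
      by metis
  qed
  ultimately show ?thesis
    unfolding is_basis_list_def by auto
qed

lemma frame_tensor_structure: "tensor_structure n m U (2^m) frame_tensor"
  unfolding tensor_structure_def
  using frame_tensor_basis frame_tensor_linear_left frame_tensor_linear_right pn_space_carrier
  by simp

end

section \<open>Pauli errors and their phase multiples as charged operators\<close>

lemma charge_ops_charged:
  assumes rep: "pauli_rep n m U" and "z2_rep n m U" and E: "E \<in> charge_ops n m U \<chi>"
  shows "z2_rep.charged n m U \<chi> E"
proof -
  interpret z2_rep n m U by fact
  have pauli: "E \<in> pauli_group n"
    using E by (simp add: charge_ops_def)
  note Ec = pauli_group_carrier[OF pauli]
  have "U g * E = \<chi> g \<cdot>\<^sub>m (E * U g)" if g: "g < 2^m" for g
  proof -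
    note Uc = rep_carrier[OF g]
    note U' = mat_adjoint_carrier[OF Uc]
    have adj: "mat_adjoint (U g) * U g = 1\<^sub>m (2^n)"
      using rep g by (intro pauli_group_unitary) (simp add: pauli_rep_def)
    \<comment> \<open>Inserting the identity exposes the conjugate of \<open>E\<close> by
      \<open>U g\<close>, which is known from the charge.\<close>
    have "U g * E = U g * E * (mat_adjoint (U g) * U g)"
      using Uc Ec by (simp add: adj)
    also have "\<dots> = U g * E * mat_adjoint (U g) * U g"
      by (rule assoc_mult_mat[OF mult_carrier_mat[OF Uc Ec] U' Uc, symmetric])
    also have "U g * E * mat_adjoint (U g) = \<chi> g \<cdot>\<^sub>m E"
      using E g by (simp add: charge_ops_def)
    also have "\<chi> g \<cdot>\<^sub>m E * U g = \<chi> g \<cdot>\<^sub>m (E * U g)"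
      by (rule mult_smult_assoc_mat[OF Ec Uc])
    finally show ?thesis .
  qed
  then show ?thesis
    unfolding charged_def using Ec pauli_group_unitary[OF pauli] by simp
qed

text \<open>Passes the charge of an error on to the frame operator, its multiple by a phase: the
  scalar commutes with \<open>U g\<close> and cancels against its conjugate.\<close>

lemma (in z2_rep) charged_smult:
  assumes A: "charged \<chi> A" and \<eta>: "cmod \<eta> = 1"
  shows "charged \<chi> (\<eta> \<cdot>\<^sub>m A)"
proof -
  have Ac: "A \<in> carrier_mat (2^n) (2^n)" and Au: "mat_adjoint A * A = 1\<^sub>m (2^n)"
    and comm: "\<And>g. g < 2^m \<Longrightarrow> U g * A = \<chi> g \<cdot>\<^sub>m (A * U g)"
    using A by (auto simp: charged_def)
  have Bc: "\<eta> \<cdot>\<^sub>m A \<in> carrier_mat (2^n) (2^n)"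
    using Ac by simp
  have \<eta>2: "cnj \<eta> * \<eta> = 1"
    using \<eta> complex_norm_square[of \<eta>] by (simp add: mult.commute)
  have "mat_adjoint (\<eta> \<cdot>\<^sub>m A) * (\<eta> \<cdot>\<^sub>m A) = mat_adjoint A * A"
  proof
    show "dim_row (mat_adjoint (\<eta> \<cdot>\<^sub>m A) * (\<eta> \<cdot>\<^sub>m A)) = dim_row (mat_adjoint A * A)"
      "dim_col (mat_adjoint (\<eta> \<cdot>\<^sub>m A) * (\<eta> \<cdot>\<^sub>m A)) = dim_col (mat_adjoint A * A)"
      using carrier_matD[OF mat_adjoint_carrier[OF Ac]] carrier_matD[OF mat_adjoint_carrier[OF Bc]] Ac
      by simp_all
    fix i j
    assume "i < dim_row (mat_adjoint A * A)" "j < dim_col (mat_adjoint A * A)"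
    then have ij: "i < 2^n" "j < 2^n"
      using carrier_matD[OF mat_adjoint_carrier[OF Ac]] Ac by simp_all
    have "(mat_adjoint (\<eta> \<cdot>\<^sub>m A) * (\<eta> \<cdot>\<^sub>m A)) $$ (i, j)
        = (\<Sum>l<2^n. (cnj \<eta> * \<eta>) * (cnj (A $$ (l, i)) * A $$ (l, j)))"
      unfolding index_mat_adjoint_mult[OF Bc Bc ij]
      by (intro sum.cong refl) (use Ac ij in \<open>simp add: mult_ac\<close>)
    then show "(mat_adjoint (\<eta> \<cdot>\<^sub>m A) * (\<eta> \<cdot>\<^sub>m A)) $$ (i, j) = (mat_adjoint A * A) $$ (i, j)"
      unfolding index_mat_adjoint_mult[OF Ac Ac ij] by (simp add: \<eta>2)
  qed
  moreover have "U g * (\<eta> \<cdot>\<^sub>m A) = \<chi> g \<cdot>\<^sub>m (\<eta> \<cdot>\<^sub>m A * U g)" if g: "g < 2^m" for g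
  proof -
    have "U g * (\<eta> \<cdot>\<^sub>m A) = \<eta> \<cdot>\<^sub>m (\<chi> g \<cdot>\<^sub>m (A * U g))"
      using mult_smult_distrib[OF rep_carrier[OF g] Ac] comm[OF g] by simp
    also have "\<dots> = \<chi> g \<cdot>\<^sub>m (\<eta> \<cdot>\<^sub>m (A * U g))"
      by (auto simp: mult_ac)
    also have "\<eta> \<cdot>\<^sub>m (A * U g) = \<eta> \<cdot>\<^sub>m A * U g"
      by (rule mult_smult_assoc_mat[OF Ac rep_carrier[OF g], symmetric])
    finally show ?thesis .
  qed
  ultimately show ?thesis
    unfolding charged_def using Bc Au by simp
qed

text \<open>Supplies the error behind the convention that the frame field of trivial charge is the
  identity.\<close>

lemma charge_ops_one:
  assumes "pauli_rep n m U" "1\<^sub>m (2^n) \<in> pauli_group n"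
  shows "1\<^sub>m (2^n) \<in> charge_ops n m U triv_char"
proof -
  have "U g * 1\<^sub>m (2^n) * mat_adjoint (U g) = triv_char g \<cdot>\<^sub>m 1\<^sub>m (2^n)" if g: "g < 2^m" for g
  proof -
    have Ug: "U g \<in> pauli_group n"
      using assms(1) g by (simp add: pauli_rep_def)
    note Uc = pauli_group_carrier[OF Ug]
    have "U g * 1\<^sub>m (2^n) * mat_adjoint (U g) = 1\<^sub>m (2^n)"
      using Uc mat_mult_left_right_inverse[OF mat_adjoint_carrier[OF Uc] Uc pauli_group_unitary[OF Ug]]
      by simp
    then show ?thesis
      by (auto simp del: right_mult_one_mat)
  qed
  then show ?thesis
    using assms(2) by (simp add: charge_ops_def)
qed

section \<open>Assembly of the frame-dependent factorisation\<close>

theorem mainTheorem4: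
  fixes n k :: nat
    and U :: "nat \<Rightarrow> complex mat"
    and Es :: "complex mat set"
    and R :: "(nat \<Rightarrow> complex) \<Rightarrow> complex vec \<Rightarrow> complex vec"
  assumes "1 \<le> n" and "k < n"
    and "pauli_rep n (n - k) U"
    and "Es \<subseteq> pauli_group n"
    and "1\<^sub>m (2^n) \<in> Es"
    and "maximal_correctable n (n - k) U Es"
    and "complete_frame n (n - k) U R"
    and "adapted n (n - k) U Es R"
  shows "\<exists>(d::nat) (T :: complex vec \<Rightarrow> complex vec \<Rightarrow> complex vec)
            (UR :: nat \<Rightarrow> complex mat) (ket :: (nat \<Rightarrow> complex) \<Rightarrow> complex vec).
     tensor_structure n (n - k) U d T \<and>
     \<comment> \<open>1. dimension, unitary representation U_R, U^g = id (x)_R U_R^g\<close>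
     d = 2^(n - k) \<and>
     (\<forall>g < 2^(n - k). UR g \<in> carrier_mat d d \<and> mat_adjoint (UR g) * UR g = 1\<^sub>m d) \<and>
     UR 0 = 1\<^sub>m d \<and>
     (\<forall>g < 2^(n - k). \<forall>h < 2^(n - k). UR (Bit_Operations.xor g h) = UR g * UR h) \<and>
     (\<forall>g < 2^(n - k). \<forall>\<psi>\<in>pn_space n (n - k) U. \<forall>w\<in>carrier_vec d.
         U g *\<^sub>v T \<psi> w = T \<psi> (UR g *\<^sub>v w)) \<and>
     \<comment> \<open>2. orthonormal basis {|chi>} with H_chi = H_pn (x)_R |chi>\<close>
     (\<forall>\<chi>\<in>chars (n - k). ket \<chi> \<in> carrier_vec d) \<and>
     (\<forall>\<chi>\<in>chars (n - k). \<forall>\<chi>'\<in>chars (n - k).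
         cinner (ket \<chi>) (ket \<chi>') = (if \<chi> = \<chi>' then 1 else 0)) \<and>
     (\<forall>w\<in>carrier_vec d. \<exists>c. w = vec d (\<lambda>t. \<Sum>\<chi>\<in>chars (n - k). c \<chi> * ket \<chi> $ t)) \<and>
     (\<forall>\<chi>\<in>chars (n - k). char_space n (n - k) U \<chi> = (\<lambda>\<psi>. T \<psi> (ket \<chi>)) ` pn_space n (n - k) U) \<and>
     \<comment> \<open>3. R_chi(psi (x) |1>) = psi (x) |chi>\<close>
     (\<forall>\<chi>\<in>chars (n - k). \<forall>\<psi>\<in>pn_space n (n - k) U.
         frame_ext R \<chi> (T \<psi> (ket triv_char)) = T \<psi> (ket \<chi>)) \<and>
     \<comment> \<open>4. errors of charge chi act as psi (x) |1> |-> eta psi (x) |chi>\<close>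
     (\<forall>\<chi>\<in>chars (n - k). \<forall>E\<in>Es \<inter> charge_ops n (n - k) U \<chi>. \<exists>\<eta>::complex. cmod \<eta> = 1 \<and>
         (\<forall>\<psi>\<in>pn_space n (n - k) U. E *\<^sub>v T \<psi> (ket triv_char) = \<eta> \<cdot>\<^sub>v T \<psi> (ket \<chi>))) \<and>
     \<comment> \<open>5. U_R is isomorphic to the regular representation\<close>
     (\<exists>S\<in>carrier_mat d d. invertible_mat S \<and>
         (\<forall>g < 2^(n - k). S * UR g = regular_rep (n - k) g * S))"
proof -
  define m where "m = n - k"
  have rep: "pauli_rep n m U" and frame: "adapted n m U Es R"
    using assms by (simp_all add: m_def)
  have rep': "z2_rep n m U"
    using rep by unfold_locales (auto simp: pauli_rep_def intro: pauli_group_carrier)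
  interpret z2_rep n m U
    by (rule rep')
  obtain C where C: "\<And>E E'. E \<in> Es \<Longrightarrow> E' \<in> Es \<Longrightarrow>
      pn_proj n m U * (mat_adjoint E * E') * pn_proj n m U = C E E' \<cdot>\<^sub>m pn_proj n m U"
    using \<open>maximal_correctable n (n - k) U Es\<close> by (auto simp: maximal_correctable_def m_def)
  \<comment> \<open>Extends adaptedness to the trivial character, where the identity, an element of
    \<open>Es\<close>, serves with phase 1.\<close>
  have "\<exists>E \<eta>. E \<in> Es \<inter> charge_ops n m U \<chi> \<and> cmod \<eta> = 1 \<and>
      (\<forall>\<psi>\<in>pn_space n m U. frame_ext R \<chi> \<psi> = \<eta> \<cdot>\<^sub>v (E *\<^sub>v \<psi>))" if \<chi>: "\<chi> \<in> chars m" for \<chi>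
  proof (cases "\<chi> = triv_char")
    case True
    have "1\<^sub>m (2^n) \<in> Es \<inter> charge_ops n m U \<chi>"
      using assms(4,5) charge_ops_one[OF rep] True by blast
    moreover have "frame_ext R \<chi> \<psi> = 1 \<cdot>\<^sub>v (1\<^sub>m (2^n) *\<^sub>v \<psi>)" if "\<psi> \<in> pn_space n m U" for \<psi>
      using that True by (simp add: frame_ext_def mem_char_space_iff)
    ultimately show ?thesis
      by (metis norm_one)
  next
    case False
    then show ?thesis
      using frame \<chi> by (simp add: adapted_def frame_ext_def) blast
  qed
  then obtain A \<eta> where A: "\<And>\<chi>. \<chi> \<in> chars m \<Longrightarrow> A \<chi> \<in> Es \<inter> charge_ops n m U \<chi>"
    and \<eta>: "\<And>\<chi>. \<chi> \<in> chars m \<Longrightarrow> cmod (\<eta> \<chi>) = 1"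
    and frame_A: "\<And>\<chi> \<psi>. \<chi> \<in> chars m \<Longrightarrow> \<psi> \<in> pn_space n m U \<Longrightarrow>
      frame_ext R \<chi> \<psi> = \<eta> \<chi> \<cdot>\<^sub>v (A \<chi> *\<^sub>v \<psi>)"
    by metis
  have A_charged: "charged \<chi> (A \<chi>)" if "\<chi> \<in> chars m" for \<chi>
    using A[OF that] charge_ops_charged[OF rep rep'] by simp
  \<comment> \<open>The phase is absorbed into the operator, so that \<open>F \<chi>\<close>
    restricts to the frame field itself and clause 3 holds with no phase left over.\<close>
  define F where "F \<chi> = \<eta> \<chi> \<cdot>\<^sub>m A \<chi>" for \<chi>
  interpret charged_frame n m U F
    by unfold_locales (simp add: F_def charged_smult A_charged \<eta>)
  have F: "F \<chi> *\<^sub>v \<psi> = \<eta> \<chi> \<cdot>\<^sub>v (A \<chi> *\<^sub>v \<psi>)" "frame_ext R \<chi> \<psi> = F \<chi> *\<^sub>v \<psi>"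
    if "\<chi> \<in> chars m" "\<psi> \<in> pn_space n m U" for \<chi> \<psi>
  proof -
    show "F \<chi> *\<^sub>v \<psi> = \<eta> \<chi> \<cdot>\<^sub>v (A \<chi> *\<^sub>v \<psi>)"
      unfolding F_def using A_charged[OF that(1)] pn_space_carrier[OF that(2)]
      by (intro smult_mat_mult_vec) (auto simp: charged_def)
    then show "frame_ext R \<chi> \<psi> = F \<chi> *\<^sub>v \<psi>"
      using frame_A that by simp
  qed
  \<comment> \<open>On the code space \<open>F triv_char\<close> is
    \<open>frame_ext R triv_char\<close>, that is, the identity.\<close>
  have ket_triv: "frame_tensor \<psi> (char_ket m triv_char) = \<psi>" if "\<psi> \<in> pn_space n m U" for \<psi>
    using F(2)[OF triv_char_in_chars that] by (simp add: frame_tensor_char_ket frame_ext_def)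
  have errors: "\<exists>\<zeta>. cmod \<zeta> = 1 \<and> (\<forall>\<psi>\<in>pn_space n m U.
      E *\<^sub>v frame_tensor \<psi> (char_ket m triv_char) = \<zeta> \<cdot>\<^sub>v frame_tensor \<psi> (char_ket m \<chi>))"
    if \<chi>: "\<chi> \<in> chars m" and E: "E \<in> Es \<inter> charge_ops n m U \<chi>" for \<chi> E
  proof -
    \<comment> \<open>\<open>E\<close> and \<open>A \<chi>\<close> are errors of the same charge, so
      correctability makes them proportional on the code space.\<close>
    obtain \<zeta> where \<zeta>: "cmod \<zeta> = 1"
      "\<And>\<psi>. \<psi> \<in> pn_space n m U \<Longrightarrow> E *\<^sub>v \<psi> = \<zeta> \<cdot>\<^sub>v (A \<chi> *\<^sub>v \<psi>)"
      using charged_proportional[OF \<chi> A_charged[OF \<chi>], of E] charge_ops_charged[OF rep rep'] E C A[OF \<chi>]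
      by blast
    have "\<eta> \<chi> \<noteq> 0"
      using \<eta>[OF \<chi>] by auto
    \<comment> \<open>On the code space \<open>E\<close> is \<open>\<zeta>\<close> times
      \<open>A \<chi>\<close> and \<open>F \<chi>\<close> is \<open>\<eta> \<chi>\<close> times
      \<open>A \<chi>\<close>; hence the quotient of phases.\<close>
    then have "E *\<^sub>v frame_tensor \<psi> (char_ket m triv_char)
        = (\<zeta> / \<eta> \<chi>) \<cdot>\<^sub>v frame_tensor \<psi> (char_ket m \<chi>)" if "\<psi> \<in> pn_space n m U" for \<psi>
      using that \<zeta>(2) F(1)[OF \<chi>] by (simp add: ket_triv frame_tensor_char_ket[OF \<chi>] smult_smult_assoc)
    moreover have "cmod (\<zeta> / \<eta> \<chi>) = 1"
      using \<zeta>(1) \<eta>[OF \<chi>] by (simp add: norm_divide)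
    ultimately show ?thesis
      by blast
  qed
  have spaces: "char_space n m U \<chi> = (\<lambda>\<psi>. frame_tensor \<psi> (char_ket m \<chi>)) ` pn_space n m U"
    if "\<chi> \<in> chars m" for \<chi>
    using charged_image_pn_space[OF that frame_charged[OF that]] by (simp add: frame_tensor_char_ket[OF that])
  have intertwiner: "\<exists>S\<in>carrier_mat (2^m) (2^m). invertible_mat S \<and>
      (\<forall>g<2^m. S * regular_rep m g = regular_rep m g * S)"
  \<comment> \<open>Since \<open>regular_rep m\<close> itself serves as the gauge representation,
    the identity intertwines.\<close>
  proof (intro bexI[of _ "1\<^sub>m (2^m)"] conjI allI impI)
    show "invertible_mat (1\<^sub>m (2^m) :: complex mat)"
      unfolding invertible_mat_def inverts_mat_def by (auto intro!: exI[of _ "1\<^sub>m (2^m)"])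
    show "1\<^sub>m (2^m) * regular_rep m g = regular_rep m g * 1\<^sub>m (2^m)" for g
      using left_mult_one_mat[OF regular_rep_carrier] right_mult_one_mat[OF regular_rep_carrier] by simp
  qed simp
  show ?thesis
    unfolding m_def[symmetric]
  proof (intro exI conjI)
    \<comment> \<open>The witnesses are left schematic by \<open>intro exI\<close>; matching the
      goals below fixes them as \<open>2^m\<close>, \<open>frame_tensor\<close>,
      \<open>regular_rep m\<close> and \<open>char_ket m\<close>.\<close>
    show "tensor_structure n m U (2^m) frame_tensor"
      by (rule frame_tensor_structure)
    show "\<forall>w\<in>carrier_vec (2^m). \<exists>c. w = vec (2^m) (\<lambda>t. \<Sum>\<chi>\<in>chars m. c \<chi> * char_ket m \<chi> $ t)"
    proof
      fix w :: "complex vec"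
      assume "w \<in> carrier_vec (2^m)"
      from fourier_inversion[OF this]
      show "\<exists>c. w = vec (2^m) (\<lambda>t. \<Sum>\<chi>\<in>chars m. c \<chi> * char_ket m \<chi> $ t)"
        by (rule exI[of _ "\<lambda>\<chi>. fourier m \<chi> w"])
    qed
    show "\<forall>\<chi>\<in>chars m. \<forall>E\<in>Es \<inter> charge_ops n m U \<chi>. \<exists>\<zeta>. cmod \<zeta> = 1 \<and>
        (\<forall>\<psi>\<in>pn_space n m U. E *\<^sub>v frame_tensor \<psi> (char_ket m triv_char)
           = \<zeta> \<cdot>\<^sub>v frame_tensor \<psi> (char_ket m \<chi>))"
      using errors by blast
    show "\<exists>S\<in>carrier_mat (2^m) (2^m). invertible_mat S \<and>
        (\<forall>g<2^m. S * regular_rep m g = regular_rep m g * S)"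
      by (rule intertwiner)
    show "\<forall>\<chi>\<in>chars m. \<forall>\<psi>\<in>pn_space n m U.
        frame_ext R \<chi> (frame_tensor \<psi> (char_ket m triv_char)) = frame_tensor \<psi> (char_ket m \<chi>)"
      by (metis F(2) ket_triv frame_tensor_char_ket)
    show "\<forall>\<chi>\<in>chars m. char_space n m U \<chi>
        = (\<lambda>\<psi>. frame_tensor \<psi> (char_ket m \<chi>)) ` pn_space n m U"
      using spaces by blast
  qed (auto simp: regular_rep_unitary regular_rep_zero regular_rep_xor rep_frame_tensor
      cinner_char_ket fourier_char_ket)
qed

end
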